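(* Let $\Lambda$ be a $k$-graph, and suppose that $i_\Lambda:\Lambda\to\Pi(\Lambda)$ is injective. (i) Let $f:\mathbb{N}^\ell\to\mathbb{N}^k$ be an affine map. Then $i:f^*(\Lambda)\to\Pi(f^*(\Lambda))$ is injective. (ii) If $\Gamma$ is an $\ell$-graph and $i_\Gamma:\Gamma\to\Pi(\Gamma)$ is injective, then $i_{\Lambda\times\Gamma}:\Lambda\times\Gamma\to\Pi(\Lambda\times\Gamma)$ is injective. (iii) If $c:\Lambda\to G$ is a $1$-cocycle into a group, then $i_{G\times_c\Lambda}:G\times_c\Lambda\to\Pi(G\times_c\Lambda)$ is injective. (iv) If $\alpha:\mathbb{N}^\ell\to\operatorname{Aut}(\Lambda)$ is an action, then there is an action $\tilde\alpha:\mathbb{Z}^\ell\to\operatorname{Aut}(\Pi(\Lambda))$ such that $\tilde\alpha_n\circ i_\Lambda=i_\Lambda\circ\alpha_n$ for $n\in\mathbb{N}^\ell$. Both $$i_\Lambda\times i_{\mathbb{N}^\ell}:\Lambda\times_\alpha\mathbb{N}^\ell\to\Pi(\Lambda)\times_{\tilde\alpha}\mathbb{Z}^\ell\quad\text{and}\quad i_{\Lambda\times_\alpha\mathbb{N}^\ell}:\Lambda\times_\alpha\mathbb{N}^\ell\to\Pi(\Lambda\times_\alpha\mathbb{N}^\ell)$$ are injective. Moreover, $i_\Lambda\times i_{\mathbb{N}^\ell}$ induces (via the universal property of $\Pi(\Lambda\times_\alpha\mathbb{N}^\ell)$) an isomorphism $\Pi(\Lambda\times_\alpha\mathbb{N}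^\ell)\cong\Pi(\Lambda)\times_{\tilde\alpha}\mathbb{Z}^\ell$.
   Context: A $k$-graph is a small category $\Lambda$ (identified with its set of morphisms) with a functor $d:\Lambda\to\mathbb{N}^k$ ($\mathbb{N}=\{0,1,\dots\}$) satisfying the factorisation property: if $d(\lambda)=m+n$ there are unique $\mu,\nu\in\Lambda$ with $d(\mu)=m$, $d(\nu)=n$, $\lambda=\mu\nu$. $\Lambda^n=d^{-1}(n)$; $\Lambda^0$ is the set of identity morphisms (vertices); $r,s$ are the codomain and domain maps, so $\lambda\mu$ is defined iff $s(\lambda)=r(\mu)$. For $0\le m\le n\le d(\lambda)$, $\lambda(m,n)$ is the unique element with $\lambda\in\Lambda^m\lambda(m,n)\Lambda^{d(\lambda)-n}$. $\operatorname{Aut}(\Lambda)$ is the group of degree-preserving automorphisms. The fundamental groupoid of $\Lambda$ is a groupoid $\Pi(\Lambda)$ with a functor $i=i_\Lambda:\Lambda\to\Pi(\Lambda)$, $i(\Lambda^0)=\Pi(\Lambda)^0$, such that every functor $F$ from $\Lambda$ to a groupoid $\mathcal G$ is $\tilde F\circ i$ for a unique groupoid homomorphism $\tilde F:\Pi(\Lambda)\to\mathcal G$. Affine pullback: an affine map $f:\mathbb{N}^\ell\to\mathbb{N}^k$ is one of the form $f(n)=An+p$ with $A$ a $k\times\ell$ matrix over $\mathbb{N}$ and $p\in\mathbb{N}^k$. $f^*(\Lambda)=\{(\lambda,n)\in\Lambda\times\mathbb{N}^\ell:d(\lambda)=f(n)\}$ is an $\ell$-graph with $r(\lambda,n)=(\lambda(0,p),0)$,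 $s(\lambda,n)=(\lambda(d(\lambda)-p,d(\lambda)),0)$, composition $(\lambda,m)\circ(\mu,n)=(\lambda(0,d(\lambda)-p)\mu,\,m+n)$ when $s(\lambda,m)=r(\mu,n)$, and degree map $(\lambda,n)\mapsto n$. Cartesian product: $\Lambda\times\Gamma$ is the product category with degree $d(\lambda,\gamma)=(d(\lambda),d(\gamma))\in\mathbb{N}^{k+\ell}$. Skew product: a $1$-cocycle is a functor $c:\Lambda\to G$ into a group $G$; $G\times_c\Lambda$ is the $k$-graph with set $G\times\Lambda$, $r(g,\lambda)=(g,r(\lambda))$, $s(g,\lambda)=(gc(\lambda),s(\lambda))$, $(g,\lambda)(gc(\lambda),\mu)=(g,\lambda\mu)$, $d(g,\lambda)=d(\lambda)$. Crossed product: an action $\alpha:\mathbb{N}^\ell\to\operatorname{Aut}(\Lambda)$ (monoid homomorphism) extends uniquely to $\mathbb{Z}^\ell$. $\Lambda\times_\alpha\mathbb{N}^\ell$ is the $(k+\ell)$-graph with set $\Lambda\times\mathbb{N}^\ell$, $r(\lambda,m)=(r(\lambda),0)$, $s(\lambda,m)=(\alpha_{-m}(s(\lambda)),0)$, $(\lambda,m)(\mu,n)=(\lambda\alpha_m(\mu),m+n)$, $d(\lambda,m)=(d(\lambda),m)$. Similarly $\Pi(\Lambda)\times_{\tilde\alpha}\mathbb{Z}^\ell$ is the semidirect-product groupoid on the set $\Pi(\Lambda)\times\mathbb{Z}^\ell$ with the same formulas: $r(\gamma,m)=(r(\gamma),0)$, $s(\gamma,m)=(\tilde\alpha_{-m}(s(\gamma)),0)$,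 $(\gamma,m)(\eta,n)=(\gamma\tilde\alpha_m(\eta),m+n)$. $i_{\mathbb{N}^\ell}:\mathbb{N}^\ell\to\mathbb{Z}^\ell$ is the inclusion, and $(i_\Lambda\times i_{\mathbb{N}^\ell})(\lambda,n)=(i_\Lambda(\lambda),n)$. *)

theory Defs
  imports "HOL-Algebra.Bij" "HOL-Library.Function_Algebras"
begin

section \<open>Small categories and groupoids\<close>

text \<open>A small category is identified with its set of morphisms: an object is its identity morphism,
  so \<open>src\<close> and \<open>rng\<close> take values in the morphisms, and \<open>x \<odot> y\<close> is meaningful iff
  \<open>src x = rng y\<close>.\<close>

record 'a cat =
  Mor :: "'a set"
  src :: "'a \<Rightarrow> 'a"
  rng :: "'a \<Rightarrow> 'a"
  cmp :: "'a \<Rightarrow> 'a \<Rightarrow> 'a" (infixl "\<odot>\<index>" 70)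

locale category =
  fixes C :: "('a, 'm) cat_scheme" (structure)
  assumes src_closed: "x \<in> Mor C \<Longrightarrow> src C x \<in> Mor C"
    and rng_closed: "x \<in> Mor C \<Longrightarrow> rng C x \<in> Mor C"
    and src_src: "x \<in> Mor C \<Longrightarrow> src C (src C x) = src C x"
    and rng_src: "x \<in> Mor C \<Longrightarrow> rng C (src C x) = src C x"
    and src_rng: "x \<in> Mor C \<Longrightarrow> src C (rng C x) = rng C x"
    and rng_rng: "x \<in> Mor C \<Longrightarrow> rng C (rng C x) = rng C x"
    and cmp_closed: "\<lbrakk>x \<in> Mor C; y \<in> Mor C; src C x = rng C y\<rbrakk> \<Longrightarrow> x \<odot> y \<in> Mor C"
    and src_cmp: "\<lbrakk>x \<in> Mor C; y \<in> Mor C; src C x = rng C y\<rbrakk> \<Longrightarrow> src C (x \<odot> y) = src C y"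
    and rng_cmp: "\<lbrakk>x \<in> Mor C; y \<in> Mor C; src C x = rng C y\<rbrakk> \<Longrightarrow> rng C (x \<odot> y) = rng C x"
    and rng_unit: "x \<in> Mor C \<Longrightarrow> rng C x \<odot> x = x"
    and src_unit: "x \<in> Mor C \<Longrightarrow> x \<odot> src C x = x"
    and cmp_assoc: "\<lbrakk>x \<in> Mor C; y \<in> Mor C; z \<in> Mor C; src C x = rng C y; src C y = rng C z\<rbrakk>
      \<Longrightarrow> (x \<odot> y) \<odot> z = x \<odot> (y \<odot> z)"

definition Obj :: "('a, 'm) cat_scheme \<Rightarrow> 'a set" where
  "Obj C = {v \<in> Mor C. rng C v = v}"

locale groupoid = category +
  assumes inverse_ex: "x \<in> Mor C \<Longrightarrow>
    \<exists>y \<in> Mor C. rng C y = src C x \<and> src C y = rng C x \<and> x \<odot> y = rng C x \<and> y \<odot> x = src C x"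

definition is_functor :: "('a, 'm) cat_scheme \<Rightarrow> ('b, 'n) cat_scheme \<Rightarrow> ('a \<Rightarrow> 'b) \<Rightarrow> bool" where
  "is_functor C D F \<longleftrightarrow>
    F \<in> Mor C \<rightarrow> Mor D \<and>
    (\<forall>x \<in> Mor C. F (src C x) = src D (F x) \<and> F (rng C x) = rng D (F x)) \<and>
    (\<forall>x \<in> Mor C. \<forall>y \<in> Mor C. src C x = rng C y \<longrightarrow> F (x \<odot>\<^bsub>C\<^esub> y) = F x \<odot>\<^bsub>D\<^esub> F y)"

definition is_cat_iso :: "('a, 'm) cat_scheme \<Rightarrow> ('b, 'n) cat_scheme \<Rightarrow> ('a \<Rightarrow> 'b) \<Rightarrow> bool" where
  "is_cat_iso C D F \<longleftrightarrow> is_functor C D F \<and> bij_betw F (Mor C) (Mor D)"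

definition Aut_cat :: "('a, 'm) cat_scheme \<Rightarrow> ('a \<Rightarrow> 'a) monoid" where
  "Aut_cat C = (BijGroup (Mor C)) \<lparr>carrier := {\<phi> \<in> Bij (Mor C). is_functor C C \<phi>}\<rparr>"


section \<open>Higher-rank graphs\<close>

text \<open>The monoid of k-tuples of naturals, and the group of k-tuples of integers, are realised by the
  sequences vanishing from index \<open>k\<close> on, with the pointwise operations; \<open>k = 0\<close> is allowed.\<close>

definition Nvec :: "nat \<Rightarrow> (nat \<Rightarrow> nat) set" where
  "Nvec k = {n. \<forall>i\<ge>k. n i = 0}"

definition Zvec :: "nat \<Rightarrow> (nat \<Rightarrow> int) set" where
  "Zvec k = {n. \<forall>i\<ge>k. n i = 0}"

definition Nmon :: "nat \<Rightarrow> (nat \<Rightarrow> nat) monoid" where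
  "Nmon k = \<lparr>carrier = Nvec k, mult = (+), one = 0\<rparr>"

definition Zgrp :: "nat \<Rightarrow> (nat \<Rightarrow> int) monoid" where
  "Zgrp k = \<lparr>carrier = Zvec k, mult = (+), one = 0\<rparr>"

definition N_to_Z :: "(nat \<Rightarrow> nat) \<Rightarrow> nat \<Rightarrow> int" where
  "N_to_Z n = (\<lambda>i. int (n i))"

definition conc :: "nat \<Rightarrow> (nat \<Rightarrow> nat) \<Rightarrow> (nat \<Rightarrow> nat) \<Rightarrow> nat \<Rightarrow> nat" where
  "conc k m n = (\<lambda>i. if i < k then m i else n (i - k))"

record 'a kgraph = "'a cat" +
  deg :: "'a \<Rightarrow> nat \<Rightarrow> nat"

locale k_graph = category \<Lambda> for k :: nat and \<Lambda> :: "('a, 'm) kgraph_scheme" (structure) +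
  assumes deg_closed: "x \<in> Mor \<Lambda> \<Longrightarrow> deg \<Lambda> x \<in> Nvec k"
    and deg_Obj: "v \<in> Obj \<Lambda> \<Longrightarrow> deg \<Lambda> v = 0"
    and deg_cmp: "\<lbrakk>x \<in> Mor \<Lambda>; y \<in> Mor \<Lambda>; src \<Lambda> x = rng \<Lambda> y\<rbrakk> \<Longrightarrow> deg \<Lambda> (x \<odot> y) = deg \<Lambda> x + deg \<Lambda> y"
    and factorisation: "\<lbrakk>x \<in> Mor \<Lambda>; m \<in> Nvec k; n \<in> Nvec k; deg \<Lambda> x = m + n\<rbrakk> \<Longrightarrow>
      \<exists>!p. case p of (\<mu>, \<nu>) \<Rightarrow> \<mu> \<in> Mor \<Lambda> \<and> \<nu> \<in> Mor \<Lambda> \<and> deg \<Lambda> \<mu> = m \<and> deg \<Lambda> \<nu> = n \<and>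
        src \<Lambda> \<mu> = rng \<Lambda> \<nu> \<and> x = \<mu> \<odot> \<nu>"

definition segment :: "('a, 'm) kgraph_scheme \<Rightarrow> 'a \<Rightarrow> (nat \<Rightarrow> nat) \<Rightarrow> (nat \<Rightarrow> nat) \<Rightarrow> 'a" where
  "segment \<Lambda> x m n = (THE y. y \<in> Mor \<Lambda> \<and>
    (\<exists>a \<in> Mor \<Lambda>. \<exists>b \<in> Mor \<Lambda>. deg \<Lambda> a = m \<and> deg \<Lambda> b = deg \<Lambda> x - n \<and>
      src \<Lambda> a = rng \<Lambda> y \<and> src \<Lambda> y = rng \<Lambda> b \<and> x = a \<odot>\<^bsub>\<Lambda>\<^esub> y \<odot>\<^bsub>\<Lambda>\<^esub> b))"

definition Aut_kgraph :: "('a, 'm) kgraph_scheme \<Rightarrow> ('a \<Rightarrow> 'a) monoid" where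
  "Aut_kgraph \<Lambda> = (BijGroup (Mor \<Lambda>)) \<lparr>carrier :=
    {\<phi> \<in> Bij (Mor \<Lambda>). is_functor \<Lambda> \<Lambda> \<phi> \<and> (\<forall>x \<in> Mor \<Lambda>. deg \<Lambda> (\<phi> x) = deg \<Lambda> x)}\<rparr>"


section \<open>Constructions of higher-rank graphs\<close>

definition affine_map :: "nat \<Rightarrow> nat \<Rightarrow> ((nat \<Rightarrow> nat) \<Rightarrow> nat \<Rightarrow> nat) \<Rightarrow> bool" where
  "affine_map l k f \<longleftrightarrow> (\<exists>(A :: nat \<Rightarrow> nat \<Rightarrow> nat) p. p \<in> Nvec k \<and>
    (\<forall>n \<in> Nvec l. f n = (\<lambda>i. if i < k then (\<Sum>j<l. A i j * n j) + p i else 0)))"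

text \<open>For an affine map \<open>f\<close>, the translation vector is \<open>f 0\<close>.\<close>

definition affine_pullback ::
  "nat \<Rightarrow> ((nat \<Rightarrow> nat) \<Rightarrow> nat \<Rightarrow> nat) \<Rightarrow> ('a, 'm) kgraph_scheme \<Rightarrow> ('a \<times> (nat \<Rightarrow> nat)) kgraph" where
  "affine_pullback l f \<Lambda> = (let p = f 0 in
    \<lparr>Mor = {(x, n). x \<in> Mor \<Lambda> \<and> n \<in> Nvec l \<and> deg \<Lambda> x = f n},
     src = (\<lambda>(x, n). (segment \<Lambda> x (deg \<Lambda> x - p) (deg \<Lambda> x), 0)),
     rng = (\<lambda>(x, n). (segment \<Lambda> x 0 p, 0)),
     cmp = (\<lambda>(x, m) (y, n). (segment \<Lambda> x 0 (deg \<Lambda> x - p) \<odot>\<^bsub>\<Lambda>\<^esub> y, m + n)),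
     deg = (\<lambda>(x, n). n)\<rparr>)"

definition prod_graph ::
  "nat \<Rightarrow> ('a, 'm) kgraph_scheme \<Rightarrow> ('b, 'n) kgraph_scheme \<Rightarrow> ('a \<times> 'b) kgraph" where
  "prod_graph k \<Lambda> \<Gamma> =
    \<lparr>Mor = Mor \<Lambda> \<times> Mor \<Gamma>,
     src = (\<lambda>(x, y). (src \<Lambda> x, src \<Gamma> y)),
     rng = (\<lambda>(x, y). (rng \<Lambda> x, rng \<Gamma> y)),
     cmp = (\<lambda>(x, y) (x', y'). (x \<odot>\<^bsub>\<Lambda>\<^esub> x', y \<odot>\<^bsub>\<Gamma>\<^esub> y')),
     deg = (\<lambda>(x, y). conc k (deg \<Lambda> x) (deg \<Gamma> y))\<rparr>"

definition cocycle :: "('a, 'm) cat_scheme \<Rightarrow> ('g, 'n) monoid_scheme \<Rightarrow> ('a \<Rightarrow> 'g) \<Rightarrow> bool" where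
  "cocycle \<Lambda> G c \<longleftrightarrow>
    c \<in> Mor \<Lambda> \<rightarrow> carrier G \<and>
    (\<forall>v \<in> Obj \<Lambda>. c v = \<one>\<^bsub>G\<^esub>) \<and>
    (\<forall>x \<in> Mor \<Lambda>. \<forall>y \<in> Mor \<Lambda>. src \<Lambda> x = rng \<Lambda> y \<longrightarrow> c (x \<odot>\<^bsub>\<Lambda>\<^esub> y) = c x \<otimes>\<^bsub>G\<^esub> c y)"

definition skew_product ::
  "('g, 'n) monoid_scheme \<Rightarrow> ('a \<Rightarrow> 'g) \<Rightarrow> ('a, 'm) kgraph_scheme \<Rightarrow> ('g \<times> 'a) kgraph" where
  "skew_product G c \<Lambda> =
    \<lparr>Mor = carrier G \<times> Mor \<Lambda>,
     src = (\<lambda>(g, x). (g \<otimes>\<^bsub>G\<^esub> c x, src \<Lambda> x)),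
     rng = (\<lambda>(g, x). (g, rng \<Lambda> x)),
     cmp = (\<lambda>(g, x) (h, y). (g, x \<odot>\<^bsub>\<Lambda>\<^esub> y)),
     deg = (\<lambda>(g, x). deg \<Lambda> x)\<rparr>"

text \<open>The automorphism written \<open>\<alpha>\<^sub>-\<^sub>m\<close> is the group inverse of \<open>\<alpha> m\<close>. Actions are
  elements of \<open>hom (Nmon l) (Aut_kgraph \<Lambda>)\<close> and \<open>hom (Zgrp l) (Aut_cat P)\<close>; as the targets are
  groups, such maps preserve the neutral element.\<close>

definition crossed_product ::
  "nat \<Rightarrow> nat \<Rightarrow> ('a, 'm) kgraph_scheme \<Rightarrow> ((nat \<Rightarrow> nat) \<Rightarrow> 'a \<Rightarrow> 'a) \<Rightarrow> ('a \<times> (nat \<Rightarrow> nat)) kgraph" where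
  "crossed_product k l \<Lambda> \<alpha> =
    \<lparr>Mor = Mor \<Lambda> \<times> Nvec l,
     src = (\<lambda>(x, m). ((inv\<^bsub>Aut_kgraph \<Lambda>\<^esub> (\<alpha> m)) (src \<Lambda> x), 0)),
     rng = (\<lambda>(x, m). (rng \<Lambda> x, 0)),
     cmp = (\<lambda>(x, m) (y, n). (x \<odot>\<^bsub>\<Lambda>\<^esub> \<alpha> m y, m + n)),
     deg = (\<lambda>(x, m). conc k (deg \<Lambda> x) m)\<rparr>"

definition semidirect_product ::
  "nat \<Rightarrow> ('a, 'm) cat_scheme \<Rightarrow> ((nat \<Rightarrow> int) \<Rightarrow> 'a \<Rightarrow> 'a) \<Rightarrow> ('a \<times> (nat \<Rightarrow> int)) cat" where
  "semidirect_product l P \<alpha> =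
    \<lparr>Mor = Mor P \<times> Zvec l,
     src = (\<lambda>(x, m). (\<alpha> (- m) (src P x), 0)),
     rng = (\<lambda>(x, m). (rng P x, 0)),
     cmp = (\<lambda>(x, m) (y, n). (x \<odot>\<^bsub>P\<^esub> \<alpha> m y, m + n))\<rparr>"


section \<open>The fundamental groupoid\<close>

text \<open>The fundamental groupoid is determined up to isomorphism by a universal property that ranges
  over groupoids in all types. Since HOL cannot quantify over types, that property is a predicate
  \<open>fundamental_groupoid\<close> carrying the type of the test groupoids as a parameter, and \<open>Pi_gpd\<close> is a
  concrete model: the formal composites and inverses of morphisms, modulo the groupoid laws and the
  composition of \<open>C\<close>. Theorem \<open>fundamental_groupoid_Pi\<close> establishes the universal property of
  this model at every type, and \<open>fundamental_groupoid_unique\<close> that it determines the pair up to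
  a unique isomorphism. A homomorphism matters only on morphisms, so for uniqueness it is taken
  extensional.\<close>

definition induces ::
  "('a, 'm) cat_scheme \<Rightarrow> ('p, 'n) cat_scheme \<Rightarrow> ('a \<Rightarrow> 'p) \<Rightarrow> ('g, 'o) cat_scheme \<Rightarrow> ('a \<Rightarrow> 'g) \<Rightarrow>
   ('p \<Rightarrow> 'g) \<Rightarrow> bool" where
  "induces C P j G F H \<longleftrightarrow>
    H \<in> extensional (Mor P) \<and> is_functor P G H \<and> (\<forall>x \<in> Mor C. H (j x) = F x)"

definition fundamental_groupoid ::
  "'g itself \<Rightarrow> ('a, 'm) cat_scheme \<Rightarrow> ('p, 'n) cat_scheme \<Rightarrow> ('a \<Rightarrow> 'p) \<Rightarrow> bool" where
  "fundamental_groupoid T C P j \<longleftrightarrow>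
    groupoid P \<and> is_functor C P j \<and> j ` Obj C = Obj P \<and>
    (\<forall>(G :: 'g cat) F. groupoid G \<and> is_functor C G F \<longrightarrow> (\<exists>!H. induces C P j G F H))"

lemma fundamental_groupoidD:
  fixes G :: "'g cat"
  assumes "fundamental_groupoid TYPE('g) C P j" "groupoid G" "is_functor C G F"
  shows "\<exists>!H. induces C P j G F H"
  using assms unfolding fundamental_groupoid_def by simp

datatype 'a gterm = Gen 'a | Mult "'a gterm" "'a gterm" | Invs "'a gterm"

fun tsrc :: "('a, 'm) cat_scheme \<Rightarrow> 'a gterm \<Rightarrow> 'a"
  and trng :: "('a, 'm) cat_scheme \<Rightarrow> 'a gterm \<Rightarrow> 'a" where
  "tsrc C (Gen x) = src C x"
| "tsrc C (Mult t u) = tsrc C u"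
| "tsrc C (Invs t) = trng C t"
| "trng C (Gen x) = rng C x"
| "trng C (Mult t u) = trng C t"
| "trng C (Invs t) = tsrc C t"

primrec wt :: "('a, 'm) cat_scheme \<Rightarrow> 'a gterm \<Rightarrow> bool" where
  "wt C (Gen x) \<longleftrightarrow> x \<in> Mor C"
| "wt C (Mult t u) \<longleftrightarrow> wt C t \<and> wt C u \<and> tsrc C t = trng C u"
| "wt C (Invs t) \<longleftrightarrow> wt C t"

inductive teq :: "('a, 'm) cat_scheme \<Rightarrow> 'a gterm \<Rightarrow> 'a gterm \<Rightarrow> bool" for C where
  teq_refl: "wt C t \<Longrightarrow> teq C t t"
| teq_sym: "teq C t u \<Longrightarrow> teq C u t"
| teq_trans: "teq C t u \<Longrightarrow> teq C u w \<Longrightarrow> teq C t w"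
| teq_Mult: "teq C t t' \<Longrightarrow> teq C u u' \<Longrightarrow> tsrc C t = trng C u \<Longrightarrow> teq C (Mult t u) (Mult t' u')"
| teq_Invs: "teq C t t' \<Longrightarrow> teq C (Invs t) (Invs t')"
| teq_cmp: "x \<in> Mor C \<Longrightarrow> y \<in> Mor C \<Longrightarrow> src C x = rng C y \<Longrightarrow>
    teq C (Mult (Gen x) (Gen y)) (Gen (x \<odot>\<^bsub>C\<^esub> y))"
| teq_assoc: "wt C t \<Longrightarrow> wt C u \<Longrightarrow> wt C w \<Longrightarrow> tsrc C t = trng C u \<Longrightarrow> tsrc C u = trng C w \<Longrightarrow>
    teq C (Mult (Mult t u) w) (Mult t (Mult u w))"
| teq_unit_left: "wt C t \<Longrightarrow> teq C (Mult (Gen (trng C t)) t) t"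
| teq_unit_right: "wt C t \<Longrightarrow> teq C (Mult t (Gen (tsrc C t))) t"
| teq_inv_right: "wt C t \<Longrightarrow> teq C (Mult t (Invs t)) (Gen (trng C t))"
| teq_inv_left: "wt C t \<Longrightarrow> teq C (Mult (Invs t) t) (Gen (tsrc C t))"

definition tclass :: "('a, 'm) cat_scheme \<Rightarrow> 'a gterm \<Rightarrow> 'a gterm set" where
  "tclass C t = {u. teq C t u}"

definition trep :: "'a gterm set \<Rightarrow> 'a gterm" where
  "trep X = (SOME t. t \<in> X)"

definition Pi_gpd :: "('a, 'm) cat_scheme \<Rightarrow> 'a gterm set cat" where
  "Pi_gpd C =
    \<lparr>Mor = tclass C ` {t. wt C t},
     src = (\<lambda>X. tclass C (Gen (tsrc C (trep X)))),
     rng = (\<lambda>X. tclass C (Gen (trng C (trep X)))),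
     cmp = (\<lambda>X Y. tclass C (Mult (trep X) (trep Y)))\<rparr>"

definition i_Pi :: "('a, 'm) cat_scheme \<Rightarrow> 'a \<Rightarrow> 'a gterm set" where
  "i_Pi C x = tclass C (Gen x)"

definition induced_hom ::
  "('a, 'm) cat_scheme \<Rightarrow> ('g, 'n) cat_scheme \<Rightarrow> ('a \<Rightarrow> 'g) \<Rightarrow> 'a gterm set \<Rightarrow> 'g" where
  "induced_hom C G F = (THE H. induces C (Pi_gpd C) (i_Pi C) G F H)"

definition ginv :: "('a, 'm) cat_scheme \<Rightarrow> 'a \<Rightarrow> 'a" where
  "ginv C x = (SOME y. y \<in> Mor C \<and> rng C y = src C x \<and> src C y = rng C x \<and>
     x \<odot>\<^bsub>C\<^esub> y = rng C x \<and> y \<odot>\<^bsub>C\<^esub> x = src C x)"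

primrec teval :: "('g, 'n) cat_scheme \<Rightarrow> ('a \<Rightarrow> 'g) \<Rightarrow> 'a gterm \<Rightarrow> 'g" where
  "teval G F (Gen x) = F x"
| "teval G F (Mult t u) = teval G F t \<odot>\<^bsub>G\<^esub> teval G F u"
| "teval G F (Invs t) = ginv G (teval G F t)"

lemma (in groupoid) ginv:
  assumes "x \<in> Mor C"
  shows "ginv C x \<in> Mor C" "rng C (ginv C x) = src C x" "src C (ginv C x) = rng C x"
    "x \<odot> ginv C x = rng C x" "ginv C x \<odot> x = src C x"
  using someI_ex[OF inverse_ex[OF assms, unfolded Bex_def]] unfolding ginv_def by auto

lemma (in groupoid) ginv_unique:
  assumes "x \<in> Mor C" "y \<in> Mor C" "src C x = rng C y" "y \<odot> x = src C x" "src C y = rng C x"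
  shows "y = ginv C x"
proof -
  note g = ginv[OF assms(1)]
  have "y = y \<odot> (x \<odot> ginv C x)" using g assms src_unit[OF assms(2)] by simp
  also have "\<dots> = (y \<odot> x) \<odot> ginv C x" using g assms by (intro cmp_assoc[symmetric]) auto
  also have "\<dots> = ginv C x" using g assms rng_unit[OF g(1)] by simp
  finally show ?thesis .
qed

context category
begin

lemma wt_ends:
  "wt C t \<Longrightarrow> tsrc C t \<in> Mor C \<and> trng C t \<in> Mor C \<and>
    src C (tsrc C t) = tsrc C t \<and> rng C (tsrc C t) = tsrc C t \<and>
    src C (trng C t) = trng C t \<and> rng C (trng C t) = trng C t"
  by (induction t) (auto simp: src_closed rng_closed src_src rng_src src_rng rng_rng)

lemma teq_ends:
  "teq C t u \<Longrightarrow> wt C t \<and> wt C u \<and> tsrc C t = tsrc C u \<and> trng C t = trng C u"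
  by (induction rule: teq.induct)
    (auto simp: wt_ends src_cmp rng_cmp cmp_closed)

lemma tclass_eq_iff: "wt C t \<Longrightarrow> tclass C t = tclass C u \<longleftrightarrow> teq C t u"
  unfolding tclass_def by (auto intro: teq_refl teq_sym teq_trans)

lemma teq_trep: "wt C t \<Longrightarrow> teq C t (trep (tclass C t))"
  unfolding trep_def tclass_def by (rule someI2[of _ t]) (auto intro: teq_refl)

lemma Mor_Pi: "X \<in> Mor (Pi_gpd C) \<longleftrightarrow> (\<exists>t. wt C t \<and> X = tclass C t)"
  by (auto simp: Pi_gpd_def)

lemma tclass_Mor: "wt C t \<Longrightarrow> tclass C t \<in> Mor (Pi_gpd C)"
  by (auto simp: Pi_gpd_def)

lemma src_Pi: "wt C t \<Longrightarrow> src (Pi_gpd C) (tclass C t) = tclass C (Gen (tsrc C t))"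
  using teq_ends[OF teq_trep[of t]] by (simp add: Pi_gpd_def)

lemma rng_Pi: "wt C t \<Longrightarrow> rng (Pi_gpd C) (tclass C t) = tclass C (Gen (trng C t))"
  using teq_ends[OF teq_trep[of t]] by (simp add: Pi_gpd_def)

lemma teq_Gen_iff:
  assumes "wt C t" "wt C u"
  shows "tclass C (Gen (tsrc C t)) = tclass C (Gen (trng C u)) \<longleftrightarrow> tsrc C t = trng C u"
  using wt_ends[OF assms(1)] wt_ends[OF assms(2)]
  by (metis teq_ends tclass_eq_iff tsrc.simps(1) wt.simps(1))

lemma cmp_Pi:
  assumes "wt C t" "wt C u" "tsrc C t = trng C u"
  shows "tclass C t \<odot>\<^bsub>Pi_gpd C\<^esub> tclass C u = tclass C (Mult t u)"
proof -
  have "teq C (Mult t u) (Mult (trep (tclass C t)) (trep (tclass C u)))"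
    using assms by (intro teq_Mult teq_trep)
  then show ?thesis
    using assms by (simp add: Pi_gpd_def tclass_eq_iff[symmetric])
qed

lemma teq_tclass: "teq C t u \<Longrightarrow> tclass C t = tclass C u"
  using teq_ends tclass_eq_iff by blast

theorem groupoid_Pi: "groupoid (Pi_gpd C)"
proof
  fix X assume "X \<in> Mor (Pi_gpd C)"
  then obtain t where t: "wt C t" "X = tclass C t" by (auto simp: Mor_Pi)
  note e = wt_ends[OF t(1)]
  have w: "wt C (Gen (tsrc C t))" "wt C (Gen (trng C t))" using e by auto
  show "src (Pi_gpd C) X \<in> Mor (Pi_gpd C)" "rng (Pi_gpd C) X \<in> Mor (Pi_gpd C)"
    using w t(1) by (auto simp: t(2) src_Pi rng_Pi intro!: tclass_Mor)
  show "src (Pi_gpd C) (src (Pi_gpd C) X) = src (Pi_gpd C) X"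
    "rng (Pi_gpd C) (src (Pi_gpd C) X) = src (Pi_gpd C) X"
    "src (Pi_gpd C) (rng (Pi_gpd C) X) = rng (Pi_gpd C) X"
    "rng (Pi_gpd C) (rng (Pi_gpd C) X) = rng (Pi_gpd C) X"
    using w e t(1) by (auto simp: t(2) src_Pi rng_Pi)
  show "rng (Pi_gpd C) X \<odot>\<^bsub>Pi_gpd C\<^esub> X = X" "X \<odot>\<^bsub>Pi_gpd C\<^esub> src (Pi_gpd C) X = X"
    using w e t(1) teq_tclass[OF teq_unit_left[OF t(1)]] teq_tclass[OF teq_unit_right[OF t(1)]]
    by (auto simp: t(2) src_Pi rng_Pi cmp_Pi)
  show "\<exists>Y \<in> Mor (Pi_gpd C). rng (Pi_gpd C) Y = src (Pi_gpd C) X \<and> src (Pi_gpd C) Y = rng (Pi_gpd C) X \<and>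
      X \<odot>\<^bsub>Pi_gpd C\<^esub> Y = rng (Pi_gpd C) X \<and> Y \<odot>\<^bsub>Pi_gpd C\<^esub> X = src (Pi_gpd C) X"
  proof (rule bexI[of _ "tclass C (Invs t)"], goal_cases)
    case 1
    have i: "wt C (Invs t)" using t by simp
    show ?case
      using i t(1) src_Pi[OF i] rng_Pi[OF i]
        teq_tclass[OF teq_inv_left[OF t(1)]] teq_tclass[OF teq_inv_right[OF t(1)]]
      by (auto simp: t(2) src_Pi rng_Pi cmp_Pi)
  next
    case 2
    show ?case using t by (auto intro!: tclass_Mor)
  qed
next
  fix X Y assume *: "X \<in> Mor (Pi_gpd C)" "Y \<in> Mor (Pi_gpd C)" "src (Pi_gpd C) X = rng (Pi_gpd C) Y"
  then obtain t u where t: "wt C t" "X = tclass C t" "wt C u" "Y = tclass C u" by (auto simp: Mor_Pi)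
  have e: "tsrc C t = trng C u" using * t by (simp add: src_Pi rng_Pi teq_Gen_iff)
  then have w: "wt C (Mult t u)" using t by simp
  have m: "X \<odot>\<^bsub>Pi_gpd C\<^esub> Y = tclass C (Mult t u)" using t e by (simp add: cmp_Pi)
  show "X \<odot>\<^bsub>Pi_gpd C\<^esub> Y \<in> Mor (Pi_gpd C)" using w m by (auto intro!: tclass_Mor)
  show "src (Pi_gpd C) (X \<odot>\<^bsub>Pi_gpd C\<^esub> Y) = src (Pi_gpd C) Y"
    unfolding m using src_Pi[OF w] src_Pi[OF t(3)] t(4) by simp
  show "rng (Pi_gpd C) (X \<odot>\<^bsub>Pi_gpd C\<^esub> Y) = rng (Pi_gpd C) X"
    unfolding m using rng_Pi[OF w] rng_Pi[OF t(1)] t(2) by simp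
  fix Z assume **: "Z \<in> Mor (Pi_gpd C)" "src (Pi_gpd C) Y = rng (Pi_gpd C) Z"
  then obtain v where v: "wt C v" "Z = tclass C v" by (auto simp: Mor_Pi)
  have e': "tsrc C u = trng C v" using ** t v by (simp add: src_Pi rng_Pi teq_Gen_iff)
  have "tclass C (Mult t u) \<odot>\<^bsub>Pi_gpd C\<^esub> tclass C v = tclass C (Mult (Mult t u) v)"
    using w v e' by (simp add: cmp_Pi)
  also have "\<dots> = tclass C (Mult t (Mult u v))"
    using t v e e' by (intro teq_tclass teq_assoc)
  also have "\<dots> = tclass C t \<odot>\<^bsub>Pi_gpd C\<^esub> tclass C (Mult u v)"
    using t v e e' by (simp add: cmp_Pi)
  also have "\<dots> = tclass C t \<odot>\<^bsub>Pi_gpd C\<^esub> (tclass C u \<odot>\<^bsub>Pi_gpd C\<^esub> tclass C v)"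
    using t v e' by (simp add: cmp_Pi)
  finally show "X \<odot>\<^bsub>Pi_gpd C\<^esub> Y \<odot>\<^bsub>Pi_gpd C\<^esub> Z = X \<odot>\<^bsub>Pi_gpd C\<^esub> (Y \<odot>\<^bsub>Pi_gpd C\<^esub> Z)"
    by (simp only: m t v cmp_Pi[OF t(1,3) e])
qed

theorem is_functor_i_Pi: "is_functor C (Pi_gpd C) (i_Pi C)"
proof -
  have w: "wt C (Gen x)" if "x \<in> Mor C" for x using that by simp
  show ?thesis
    unfolding is_functor_def i_Pi_def
    using src_Pi[OF w] rng_Pi[OF w] cmp_Pi[OF w w] teq_tclass[OF teq_cmp]
    by (auto intro: w tclass_Mor)
qed

theorem i_Pi_Obj: "i_Pi C ` Obj C = Obj (Pi_gpd C)"
proof (intro equalityI subsetI)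
  fix X assume "X \<in> i_Pi C ` Obj C"
  then obtain v where "v \<in> Mor C" "rng C v = v" "X = i_Pi C v" by (auto simp: Obj_def)
  then show "X \<in> Obj (Pi_gpd C)"
    using is_functor_i_Pi by (auto simp: Obj_def is_functor_def)
next
  fix X assume "X \<in> Obj (Pi_gpd C)"
  then obtain t where t: "wt C t" "X = tclass C t" "rng (Pi_gpd C) X = X"
    by (auto simp: Obj_def Mor_Pi)
  then have "X = i_Pi C (trng C t)" by (simp add: rng_Pi i_Pi_def)
  then show "X \<in> i_Pi C ` Obj C" using wt_ends[OF t(1)] by (auto simp: Obj_def)
qed

lemma teval_wt:
  assumes G: "groupoid G" and F: "is_functor C G F" and "wt C t"
  shows "teval G F t \<in> Mor G \<and> src G (teval G F t) = F (tsrc C t) \<and>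
    rng G (teval G F t) = F (trng C t)"
  using assms(3)
proof (induction t)
  case (Gen x)
  then show ?case using F by (auto simp: is_functor_def)
next
  case (Mult t u)
  interpret G: groupoid G by fact
  show ?case using Mult by (auto simp: G.cmp_closed G.src_cmp G.rng_cmp)
next
  case (Invs t)
  interpret G: groupoid G by fact
  show ?case using Invs by (auto simp: G.ginv)
qed

lemma teval_teq:
  assumes G: "groupoid G" and F: "is_functor C G F" and "teq C t u"
  shows "teval G F t = teval G F u"
  using assms(3)
proof (induction rule: teq.induct)
  case (teq_cmp x y)
  then show ?case using F by (auto simp: is_functor_def)
next
  case (teq_assoc t u w)
  interpret G: groupoid G by fact
  show ?case using teq_assoc teval_wt[OF G F] by (auto intro!: G.cmp_assoc)
next
  case (teq_unit_left t)
  interpret G: groupoid G by fact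
  show ?case using teval_wt[OF G F teq_unit_left] G.rng_unit by (metis teval.simps(1,2))
next
  case (teq_unit_right t)
  interpret G: groupoid G by fact
  show ?case using teval_wt[OF G F teq_unit_right] G.src_unit by (metis teval.simps(1,2))
next
  case (teq_inv_right t)
  interpret G: groupoid G by fact
  show ?case using teval_wt[OF G F teq_inv_right] G.ginv by auto
next
  case (teq_inv_left t)
  interpret G: groupoid G by fact
  show ?case using teval_wt[OF G F teq_inv_left] G.ginv by auto
qed auto

lemma functor_Pi_eq_teval:
  assumes G: "groupoid G" and F: "is_functor C G F"
    and H: "is_functor (Pi_gpd C) G H" "\<And>x. x \<in> Mor C \<Longrightarrow> H (i_Pi C x) = F x"
    and "wt C t"
  shows "H (tclass C t) = teval G F t"
  using assms(5)
proof (induction t)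
  case (Gen x)
  then show ?case using H(2) by (auto simp: i_Pi_def)
next
  case (Mult t u)
  have "tclass C (Mult t u) = tclass C t \<odot>\<^bsub>Pi_gpd C\<^esub> tclass C u"
    using Mult.prems by (simp add: cmp_Pi)
  moreover have "src (Pi_gpd C) (tclass C t) = rng (Pi_gpd C) (tclass C u)"
    using Mult.prems by (simp add: src_Pi rng_Pi)
  moreover have "tclass C t \<in> Mor (Pi_gpd C)" "tclass C u \<in> Mor (Pi_gpd C)"
    using Mult.prems by (auto intro!: tclass_Mor)
  ultimately show ?case using H(1) Mult by (auto simp: is_functor_def)
next
  case (Invs t)
  interpret G: groupoid G by fact
  have t: "wt C t" and i: "wt C (Invs t)" using Invs.prems by auto
  have M: "tclass C t \<in> Mor (Pi_gpd C)" "tclass C (Invs t) \<in> Mor (Pi_gpd C)"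
    using t i by (auto intro!: tclass_Mor)
  have e: "src (Pi_gpd C) (tclass C t) = rng (Pi_gpd C) (tclass C (Invs t))"
    "rng (Pi_gpd C) (tclass C t) = src (Pi_gpd C) (tclass C (Invs t))"
    using src_Pi[OF i] rng_Pi[OF i] t by (auto simp: src_Pi rng_Pi)
  have p: "tclass C (Invs t) \<odot>\<^bsub>Pi_gpd C\<^esub> tclass C t = src (Pi_gpd C) (tclass C t)"
    using t i teq_tclass[OF teq_inv_left[OF t]] by (simp add: cmp_Pi src_Pi)
  have "H (tclass C (Invs t)) = ginv G (H (tclass C t))"
  proof (rule G.ginv_unique)
    have f: "H X \<in> Mor G" "H (src (Pi_gpd C) X) = src G (H X)" "H (rng (Pi_gpd C) X) = rng G (H X)"
      if "X \<in> Mor (Pi_gpd C)" for X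
      using H(1) that by (auto simp: is_functor_def)
    show "H (tclass C t) \<in> Mor G" "H (tclass C (Invs t)) \<in> Mor G" using f M by auto
    show "src G (H (tclass C t)) = rng G (H (tclass C (Invs t)))"
      "src G (H (tclass C (Invs t))) = rng G (H (tclass C t))"
      using f M e by metis+
    have "H (tclass C (Invs t) \<odot>\<^bsub>Pi_gpd C\<^esub> tclass C t) = H (tclass C (Invs t)) \<odot>\<^bsub>G\<^esub> H (tclass C t)"
      using H(1) M e by (simp add: is_functor_def)
    then show "H (tclass C (Invs t)) \<odot>\<^bsub>G\<^esub> H (tclass C t) = src G (H (tclass C t))"
      using p f(2)[OF M(1)] by simp
  qed
  then show ?case using Invs by simp
qed

theorem fundamental_groupoid_Pi:
  "fundamental_groupoid TYPE('g) C (Pi_gpd C) (i_Pi C)"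
  unfolding fundamental_groupoid_def
proof (intro conjI allI impI groupoid_Pi is_functor_i_Pi i_Pi_Obj)
  fix G :: "'g cat" and F
  assume "groupoid G \<and> is_functor C G F"
  then have G: "groupoid G" and F: "is_functor C G F" by auto
  interpret G: groupoid G by fact
  define H where "H = (\<lambda>X \<in> Mor (Pi_gpd C). teval G F (trep X))"
  have H: "H (tclass C t) = teval G F t" if "wt C t" for t
    using that teval_teq[OF G F teq_trep[OF that]] by (simp add: H_def tclass_Mor)
  have HF: "is_functor (Pi_gpd C) G H"
    unfolding is_functor_def
  proof (intro conjI ballI impI funcsetI)
    fix X assume "X \<in> Mor (Pi_gpd C)"
    then obtain t where t: "wt C t" "X = tclass C t" by (auto simp: Mor_Pi)
    note e = wt_ends[OF t(1)] and v = teval_wt[OF G F t(1)]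
    show "H X \<in> Mor G" "H (src (Pi_gpd C) X) = src G (H X)" "H (rng (Pi_gpd C) X) = rng G (H X)"
      using t e v by (auto simp: H src_Pi rng_Pi)
    fix Y assume "Y \<in> Mor (Pi_gpd C)" and s: "src (Pi_gpd C) X = rng (Pi_gpd C) Y"
    then obtain u where u: "wt C u" "Y = tclass C u" by (auto simp: Mor_Pi)
    have "tsrc C t = trng C u" using s t u by (simp add: src_Pi rng_Pi teq_Gen_iff)
    then show "H (X \<odot>\<^bsub>Pi_gpd C\<^esub> Y) = H X \<odot>\<^bsub>G\<^esub> H Y"
      using t u by (simp add: cmp_Pi H)
  qed
  show "\<exists>!H. induces C (Pi_gpd C) (i_Pi C) G F H"
  proof (rule ex1I[of _ H])
    show "induces C (Pi_gpd C) (i_Pi C) G F H"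
      using HF H by (auto simp: induces_def H_def i_Pi_def)
  next
    fix H' assume H': "induces C (Pi_gpd C) (i_Pi C) G F H'"
    show "H' = H"
    proof (rule extensionalityI[of _ "Mor (Pi_gpd C)"])
      show "H' \<in> extensional (Mor (Pi_gpd C))" using H' by (simp add: induces_def)
      show "H \<in> extensional (Mor (Pi_gpd C))" by (simp add: H_def)
      fix X assume "X \<in> Mor (Pi_gpd C)"
      then obtain t where t: "wt C t" "X = tclass C t" by (auto simp: Mor_Pi)
      show "H' X = H X"
        using H' t functor_Pi_eq_teval[OF G F _ _ t(1), of H'] by (auto simp: induces_def H)
    qed
  qed
qed

lemma induces_compose:
  assumes "induces C A a D d f" "induces C D d B b g" "a \<in> Mor C \<rightarrow> Mor A" "category A"
  shows "induces C A a B b (compose (Mor A) g f)"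
proof -
  interpret A: category A by fact
  have f: "f x \<in> Mor D" "f (src A x) = src D (f x)" "f (rng A x) = rng D (f x)"
    if "x \<in> Mor A" for x
    using assms(1) that by (auto simp: induces_def is_functor_def)
  have g: "g x \<in> Mor B" "g (src D x) = src B (g x)" "g (rng D x) = rng B (g x)"
    if "x \<in> Mor D" for x
    using assms(2) that by (auto simp: induces_def is_functor_def)
  have m: "g (f (x \<odot>\<^bsub>A\<^esub> y)) = g (f x) \<odot>\<^bsub>B\<^esub> g (f y)"
    if "x \<in> Mor A" "y \<in> Mor A" "src A x = rng A y" for x y
  proof -
    have "src D (f x) = rng D (f y)" using that f by metis
    then show ?thesis using assms(1,2) that f(1) by (simp add: induces_def is_functor_def)
  qed
  have "g (f (a x)) = b x" if "x \<in> Mor C" for x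
    using assms(1,2) that by (simp add: induces_def)
  then show ?thesis
    using assms(3) f g m
    by (auto simp: induces_def is_functor_def compose_def A.src_closed A.rng_closed
        A.cmp_closed Pi_iff)
qed

lemma induces_id:
  assumes "a \<in> Mor C \<rightarrow> Mor A" "category A"
  shows "induces C A a A a (\<lambda>x \<in> Mor A. x)"
proof -
  interpret A: category A by fact
  show ?thesis using assms(1)
    by (auto simp: induces_def is_functor_def A.src_closed A.rng_closed A.cmp_closed)
qed

theorem fundamental_groupoid_unique:
  fixes P :: "'p cat"
  assumes "fundamental_groupoid TYPE('p) C P j"
    and "fundamental_groupoid TYPE('a gterm set) C P j"
  shows "\<exists>!H. induces C (Pi_gpd C) (i_Pi C) P j H"
    and "is_cat_iso (Pi_gpd C) P (induced_hom C P j)"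
    and "inj_on j (Mor C) \<longleftrightarrow> inj_on (i_Pi C) (Mor C)"
proof -
  have P: "groupoid P" "is_functor C P j" using assms(1) by (auto simp: fundamental_groupoid_def)
  note Q = groupoid_Pi is_functor_i_Pi
  show ex: "\<exists>!H. induces C (Pi_gpd C) (i_Pi C) P j H"
    by (rule fundamental_groupoidD[OF fundamental_groupoid_Pi P])
  define H where "H = induced_hom C P j"
  have H: "induces C (Pi_gpd C) (i_Pi C) P j H"
    unfolding H_def induced_hom_def by (rule theI'[OF ex])
  obtain K where K: "induces C P j (Pi_gpd C) (i_Pi C) K"
    using fundamental_groupoidD[OF assms(2) Q] by auto
  have fP: "H \<in> Mor (Pi_gpd C) \<rightarrow> Mor P" "K \<in> Mor P \<rightarrow> Mor (Pi_gpd C)"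
    "i_Pi C \<in> Mor C \<rightarrow> Mor (Pi_gpd C)" "j \<in> Mor C \<rightarrow> Mor P"
    using H K Q P by (auto simp: induces_def is_functor_def)
  have cats: "category P" "category (Pi_gpd C)"
    using P(1) Q(1) by (auto simp: groupoid_def)
  have KH: "compose (Mor (Pi_gpd C)) K H = (\<lambda>x \<in> Mor (Pi_gpd C). x)"
    by (rule ex1E[OF fundamental_groupoidD[OF fundamental_groupoid_Pi Q]])
      (metis induces_compose[OF H K fP(3) cats(2)] induces_id[OF fP(3) cats(2)])
  have HK: "compose (Mor P) H K = (\<lambda>x \<in> Mor P. x)"
    by (rule ex1E[OF fundamental_groupoidD[OF assms(1) P]])
      (metis induces_compose[OF K H fP(4) cats(1)] induces_id[OF fP(4) cats(1)])
  have bij: "bij_betw H (Mor (Pi_gpd C)) (Mor P)"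
    using fP(1,2)
  proof (rule bij_betwI)
    show "K (H x) = x" if "x \<in> Mor (Pi_gpd C)" for x
      using that fun_cong[OF KH, of x] by (simp add: compose_def)
    show "H (K y) = y" if "y \<in> Mor P" for y
      using that fun_cong[OF HK, of y] by (simp add: compose_def)
  qed
  then show "is_cat_iso (Pi_gpd C) P (induced_hom C P j)"
    using H by (simp add: is_cat_iso_def induces_def H_def)
  have "inj_on j (Mor C) \<longleftrightarrow> inj_on (H \<circ> i_Pi C) (Mor C)"
    using H by (intro inj_on_cong) (auto simp: induces_def)
  also have "\<dots> \<longleftrightarrow> inj_on (i_Pi C) (Mor C)"
  proof -
    have "inj_on H (i_Pi C ` Mor C)"
      using bij fP(3) by (auto simp: bij_betw_def intro: inj_on_subset)
    then show ?thesis using comp_inj_on[of "i_Pi C" "Mor C" H] inj_on_imageI2 by blast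
  qed
  finally show "inj_on j (Mor C) \<longleftrightarrow> inj_on (i_Pi C) (Mor C)" .
qed

end

end

theory Submission
  imports Defs
begin

text \<open>If \<open>F\<close> is a functor from \<open>C\<close> to a groupoid, then \<open>i_Pi C x = i_Pi C y\<close> forces
  \<open>F x = F y\<close>; it also forces \<open>x\<close> and \<open>y\<close> to have the same range and source. So injectivity
  of \<open>i_Pi C\<close> follows from enough functors on \<open>C\<close>. For an affine pullback these are the
  degree and \<open>(x, n) \<mapsto> i_Pi \<Lambda> (x(0, d(x) - p))\<close>, where the missing segment
  \<open>x(d(x) - p, d(x))\<close> is recorded by the source; for products and skew products they are projections
  to the factors. For a crossed product, the action extends to \<open>\<int>\<^sup>l\<close> and by functoriality to
  \<open>Pi_gpd \<Lambda>\<close>, and \<open>i_Pi \<Lambda> \<times> N_to_Z\<close> embeds the crossed product in the semidirect product. The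
  latter has the universal property: a functor \<open>F\<close> on the crossed product is extended by
  \<open>F (v, m - n) = F (v, m) F (\<alpha>\<^sub>n\<^sub>-\<^sub>m v, n)\<^sup>-\<^sup>1\<close> on vertices.\<close>

section \<open>Functors and the canonical map\<close>

text \<open>A k-graph need not embed in its fundamental groupoid, and terms have no normal form. An
  equality of classes is therefore exploited only through invariants of \<open>teq\<close>: the ends
  of a term and its values in groupoids. In the semidirect product \<open>(g, z)\<close> is
  \<open>(g, 0)\<close> times \<open>(src g, z)\<close>, so an extension \<open>H\<close> of a
  functor \<open>F\<close> must be the product of a functor on \<open>Pi_gpd \<Lambda>\<close> and a
  cocycle \<open>U\<close> on vertices. That this product is multiplicative comes down to the
  exchange law \<open>H (g, 0) U (src g) z = U (rng g) z H (\<gamma> (- z) g, 0)\<close>. For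
  \<open>g\<close> coming from \<open>\<Lambda>\<close> and natural \<open>z\<close> it expresses
  two factorisations of one morphism of the crossed product. Right cancellation carries it to
  integer \<open>z\<close>, and induction over the formation of groupoid elements carries it to all
  \<open>g\<close>.\<close>

lemma functor_closed: "is_functor C D F \<Longrightarrow> x \<in> Mor C \<Longrightarrow> F x \<in> Mor D"
  and functor_src: "is_functor C D F \<Longrightarrow> x \<in> Mor C \<Longrightarrow> F (src C x) = src D (F x)"
  and functor_rng: "is_functor C D F \<Longrightarrow> x \<in> Mor C \<Longrightarrow> F (rng C x) = rng D (F x)"
  and functor_cmp: "is_functor C D F \<Longrightarrow> x \<in> Mor C \<Longrightarrow> y \<in> Mor C \<Longrightarrow> src C x = rng C y \<Longrightarrow>
    F (x \<odot>\<^bsub>C\<^esub> y) = F x \<odot>\<^bsub>D\<^esub> F y"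
  by (auto simp: is_functor_def)

lemma functorI:
  assumes "\<And>x. x \<in> Mor C \<Longrightarrow> F x \<in> Mor D"
    and "\<And>x. x \<in> Mor C \<Longrightarrow> F (src C x) = src D (F x)"
    and "\<And>x. x \<in> Mor C \<Longrightarrow> F (rng C x) = rng D (F x)"
    and "\<And>x y. x \<in> Mor C \<Longrightarrow> y \<in> Mor C \<Longrightarrow> src C x = rng C y \<Longrightarrow>
      F (x \<odot>\<^bsub>C\<^esub> y) = F x \<odot>\<^bsub>D\<^esub> F y"
  shows "is_functor C D F"
  using assms by (auto simp: is_functor_def)

lemma functor_comp:
  assumes "is_functor C D F" "is_functor D E H"
  shows "is_functor C E (\<lambda>x. H (F x))"
proof (rule functorI)
  fix x y assume "x \<in> Mor C" "y \<in> Mor C" "src C x = rng C y"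
  moreover from this have "src D (F x) = rng D (F y)"
    using functor_src[OF assms(1)] functor_rng[OF assms(1)] by metis
  ultimately show "H (F (x \<odot>\<^bsub>C\<^esub> y)) = H (F x) \<odot>\<^bsub>E\<^esub> H (F y)"
    using functor_cmp[OF assms(1)] functor_cmp[OF assms(2)] functor_closed[OF assms(1)] by simp
qed (use assms in \<open>auto simp: is_functor_def\<close>)

context category
begin

lemma ObjD: "v \<in> Obj C \<Longrightarrow> v \<in> Mor C" "v \<in> Obj C \<Longrightarrow> rng C v = v" "v \<in> Obj C \<Longrightarrow> src C v = v"
  using src_rng by (force simp: Obj_def)+

lemma src_Obj: "x \<in> Mor C \<Longrightarrow> src C x \<in> Obj C" and rng_Obj: "x \<in> Mor C \<Longrightarrow> rng C x \<in> Obj C"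
  by (auto simp: Obj_def src_closed rng_closed rng_src rng_rng)

lemma i_Pi_eq_teq: "x \<in> Mor C \<Longrightarrow> i_Pi C x = i_Pi C y \<longleftrightarrow> teq C (Gen x) (Gen y)"
  unfolding i_Pi_def by (simp add: tclass_eq_iff)

text \<open>Every rule generating \<open>teq\<close> preserves both ends of a term.\<close>

lemma i_Pi_eq_ends:
  assumes "i_Pi C x = i_Pi C y" "x \<in> Mor C"
  shows "src C x = src C y" "rng C x = rng C y"
  using teq_ends assms i_Pi_eq_teq by fastforce+

lemma i_Pi_eq_gpd:
  assumes "i_Pi C x = i_Pi C y" "x \<in> Mor C" "groupoid G" "is_functor C G F"
  shows "F x = F y"
  using teval_teq[OF assms(3,4)] assms(1,2) i_Pi_eq_teq by fastforce

text \<open>Apply \<open>i_Pi_eq_gpd\<close> to \<open>F\<close> followed by \<open>i_Pi D\<close>.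
  The target may thus be any category; if \<open>i_Pi D\<close> is injective on
  \<open>Mor D\<close>, then \<open>F x = F y\<close> follows for \<open>y\<close> in
  \<open>Mor C\<close>.\<close>

lemma i_Pi_eq_functor:
  assumes "i_Pi C x = i_Pi C y" "x \<in> Mor C" "category D" "is_functor C D F"
  shows "i_Pi D (F x) = i_Pi D (F y)"
proof -
  interpret D: category D by fact
  show ?thesis
    by (rule i_Pi_eq_gpd[OF assms(1,2) D.groupoid_Pi functor_comp[OF assms(4) D.is_functor_i_Pi]])
qed

end

text \<open>The unit serves as the only object. Cocycles into a group become functors into a
  groupoid, and so do monoid homomorphisms from natural vectors, which lets both use the groupoid
  results.\<close>

definition group_cat :: "('g, 'n) monoid_scheme \<Rightarrow> 'g cat" where
  "group_cat G = \<lparr>Mor = carrier G, src = (\<lambda>_. \<one>\<^bsub>G\<^esub>), rng = (\<lambda>_. \<one>\<^bsub>G\<^esub>), cmp = mult G\<rparr>"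

lemma groupoid_group_cat:
  assumes "group G"
  shows "groupoid (group_cat G)"
proof -
  interpret group G by fact
  show ?thesis
    by unfold_locales (auto simp: group_cat_def m_assoc intro!: bexI[where x = "inv\<^bsub>G\<^esub> _"])
qed

lemma (in category) i_Pi_eq_cocycle:
  assumes "i_Pi C x = i_Pi C y" "x \<in> Mor C" "group G" "cocycle C G c"
  shows "c x = c y"
  by (rule i_Pi_eq_gpd[OF assms(1,2) groupoid_group_cat[OF assms(3)]])
    (use assms(4) src_Obj rng_Obj in \<open>auto simp: cocycle_def is_functor_def group_cat_def\<close>)

lemma group_Zgrp: "group (Zgrp l)"
proof (rule groupI)
  fix n assume "n \<in> carrier (Zgrp l)"
  then show "\<exists>m \<in> carrier (Zgrp l). m \<otimes>\<^bsub>Zgrp l\<^esub> n = \<one>\<^bsub>Zgrp l\<^esub>"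
    by (intro bexI[of _ "- n"]) (auto simp: Zgrp_def Zvec_def)
qed (auto simp: Zgrp_def Zvec_def add.assoc)

lemma N_to_Z_add: "N_to_Z (m + n) = N_to_Z m + N_to_Z n"
  and N_to_Z_0: "N_to_Z 0 = 0"
  and N_to_Z_inject: "N_to_Z m = N_to_Z n \<longleftrightarrow> m = n"
  and N_to_Z_Zvec: "n \<in> Nvec l \<Longrightarrow> N_to_Z n \<in> Zvec l"
  by (auto simp: N_to_Z_def Nvec_def Zvec_def fun_eq_iff)

lemma Nvec_0: "0 \<in> Nvec l"
  and Nvec_add: "m \<in> Nvec l \<Longrightarrow> n \<in> Nvec l \<Longrightarrow> m + n \<in> Nvec l"
  by (auto simp: Nvec_def)


section \<open>Affine pullbacks\<close>

context k_graph
begin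

lemma factor_ex:
  assumes "x \<in> Mor \<Lambda>" "deg \<Lambda> x = m + n" "m \<in> Nvec k" "n \<in> Nvec k"
  obtains \<mu> \<nu> where "\<mu> \<in> Mor \<Lambda>" "\<nu> \<in> Mor \<Lambda>" "deg \<Lambda> \<mu> = m" "deg \<Lambda> \<nu> = n"
    "src \<Lambda> \<mu> = rng \<Lambda> \<nu>" "x = \<mu> \<odot> \<nu>"
  using factorisation[OF assms(1,3,4,2)] by auto

lemma factor_unique:
  assumes "\<mu> \<in> Mor \<Lambda>" "\<nu> \<in> Mor \<Lambda>" "\<mu>' \<in> Mor \<Lambda>" "\<nu>' \<in> Mor \<Lambda>"
    and "src \<Lambda> \<mu> = rng \<Lambda> \<nu>" "src \<Lambda> \<mu>' = rng \<Lambda> \<nu>'" "\<mu> \<odot> \<nu> = \<mu>' \<odot> \<nu>'"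
    and "deg \<Lambda> \<mu> = deg \<Lambda> \<mu>'" "deg \<Lambda> \<nu> = deg \<Lambda> \<nu>'"
  shows "\<mu> = \<mu>' \<and> \<nu> = \<nu>'"
proof -
  have "\<exists>!p. case p of (\<mu>', \<nu>') \<Rightarrow> \<mu>' \<in> Mor \<Lambda> \<and> \<nu>' \<in> Mor \<Lambda> \<and> deg \<Lambda> \<mu>' = deg \<Lambda> \<mu> \<and>
    deg \<Lambda> \<nu>' = deg \<Lambda> \<nu> \<and> src \<Lambda> \<mu>' = rng \<Lambda> \<nu>' \<and> \<mu> \<odot> \<nu> = \<mu>' \<odot> \<nu>'"
    using assms by (intro factorisation cmp_closed deg_cmp deg_closed)
  then obtain p where "\<And>q. (case q of (\<mu>', \<nu>') \<Rightarrow> \<mu>' \<in> Mor \<Lambda> \<and> \<nu>' \<in> Mor \<Lambda> \<and>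
    deg \<Lambda> \<mu>' = deg \<Lambda> \<mu> \<and> deg \<Lambda> \<nu>' = deg \<Lambda> \<nu> \<and> src \<Lambda> \<mu>' = rng \<Lambda> \<nu>' \<and>
    \<mu> \<odot> \<nu> = \<mu>' \<odot> \<nu>') \<Longrightarrow> q = p" by blast
  from this[of "(\<mu>, \<nu>)"] this[of "(\<mu>', \<nu>')"] show ?thesis using assms by simp
qed

text \<open>Both \<open>rng \<Lambda> x \<odot> x\<close> and
  \<open>x \<odot> src \<Lambda> x\<close> factor \<open>x\<close> into degrees 0 and 0, so
  uniqueness identifies the factors.\<close>

lemma deg_0_unit:
  assumes "x \<in> Mor \<Lambda>" "deg \<Lambda> x = 0"
  shows "rng \<Lambda> x = x" "src \<Lambda> x = x"
proof -
  have d: "deg \<Lambda> (rng \<Lambda> x) = 0" "deg \<Lambda> (src \<Lambda> x) = 0"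
    using assms by (auto intro!: deg_Obj rng_Obj src_Obj)
  have "rng \<Lambda> x = x \<and> x = src \<Lambda> x"
    using assms d
    by (intro factor_unique) (auto simp: rng_closed src_closed src_rng rng_src rng_unit src_unit)
  then show "rng \<Lambda> x = x" "src \<Lambda> x = x" by auto
qed

text \<open>This replaces the description operator by a computation. In any competing decomposition
  the leading factor has degree 0 and is an identity, and the degree of the last factor is forced,
  so unique factorisation applies.\<close>

lemma segment_initial:
  assumes "\<mu> \<in> Mor \<Lambda>" "\<nu> \<in> Mor \<Lambda>" "src \<Lambda> \<mu> = rng \<Lambda> \<nu>"
  shows "segment \<Lambda> (\<mu> \<odot> \<nu>) 0 (deg \<Lambda> \<mu>) = \<mu>"
  unfolding segment_def
proof (rule the_equality)
  have "deg \<Lambda> (rng \<Lambda> \<mu>) = 0" by (intro deg_Obj rng_Obj assms)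
  then show "\<mu> \<in> Mor \<Lambda> \<and> (\<exists>a\<in>Mor \<Lambda>. \<exists>b\<in>Mor \<Lambda>. deg \<Lambda> a = 0 \<and>
      deg \<Lambda> b = deg \<Lambda> (\<mu> \<odot> \<nu>) - deg \<Lambda> \<mu> \<and> src \<Lambda> a = rng \<Lambda> \<mu> \<and> src \<Lambda> \<mu> = rng \<Lambda> b \<and>
      \<mu> \<odot> \<nu> = a \<odot> \<mu> \<odot> b)"
    using assms
    by (intro conjI bexI[of _ "rng \<Lambda> \<mu>"] bexI[of _ \<nu>])
      (auto simp: deg_cmp src_rng rng_unit rng_closed fun_eq_iff)
next
  fix y assume "y \<in> Mor \<Lambda> \<and> (\<exists>a\<in>Mor \<Lambda>. \<exists>b\<in>Mor \<Lambda>. deg \<Lambda> a = 0 \<and>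
      deg \<Lambda> b = deg \<Lambda> (\<mu> \<odot> \<nu>) - deg \<Lambda> \<mu> \<and> src \<Lambda> a = rng \<Lambda> y \<and> src \<Lambda> y = rng \<Lambda> b \<and>
      \<mu> \<odot> \<nu> = a \<odot> y \<odot> b)"
  then obtain a b where y: "y \<in> Mor \<Lambda>" "a \<in> Mor \<Lambda>" "b \<in> Mor \<Lambda>" "deg \<Lambda> a = 0"
    "deg \<Lambda> b = deg \<Lambda> (\<mu> \<odot> \<nu>) - deg \<Lambda> \<mu>" "src \<Lambda> a = rng \<Lambda> y" "src \<Lambda> y = rng \<Lambda> b"
    "\<mu> \<odot> \<nu> = a \<odot> y \<odot> b" by auto
  have "a \<odot> y = y" using y deg_0_unit[of a] rng_unit[of y] by simp
  then have e: "\<mu> \<odot> \<nu> = y \<odot> b" using y by simp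
  have b: "deg \<Lambda> b = deg \<Lambda> \<nu>" using y(5) assms by (auto simp: deg_cmp fun_eq_iff)
  have "deg \<Lambda> \<mu> + deg \<Lambda> \<nu> = deg \<Lambda> y + deg \<Lambda> b"
    using arg_cong[OF e, of "deg \<Lambda>"] deg_cmp[OF assms] deg_cmp[of y b] y(1,3,7) by simp
  then have "deg \<Lambda> \<mu> = deg \<Lambda> y" using b by (auto simp: fun_eq_iff)
  then show "y = \<mu>" using factor_unique[of \<mu> \<nu> y b] assms y e b by simp
qed

lemma segment_final:
  assumes "\<mu> \<in> Mor \<Lambda>" "\<nu> \<in> Mor \<Lambda>" "src \<Lambda> \<mu> = rng \<Lambda> \<nu>"
  shows "segment \<Lambda> (\<mu> \<odot> \<nu>) (deg \<Lambda> \<mu>) (deg \<Lambda> (\<mu> \<odot> \<nu>)) = \<nu>"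
  unfolding segment_def
proof (rule the_equality)
  have "deg \<Lambda> (src \<Lambda> \<nu>) = 0" by (intro deg_Obj src_Obj assms)
  moreover have "\<mu> \<odot> \<nu> \<odot> src \<Lambda> \<nu> = \<mu> \<odot> \<nu>"
    using src_unit[OF cmp_closed[OF assms]] assms by (simp add: src_cmp)
  ultimately show "\<nu> \<in> Mor \<Lambda> \<and> (\<exists>a\<in>Mor \<Lambda>. \<exists>b\<in>Mor \<Lambda>. deg \<Lambda> a = deg \<Lambda> \<mu> \<and>
      deg \<Lambda> b = deg \<Lambda> (\<mu> \<odot> \<nu>) - deg \<Lambda> (\<mu> \<odot> \<nu>) \<and> src \<Lambda> a = rng \<Lambda> \<nu> \<and> src \<Lambda> \<nu> = rng \<Lambda> b \<and>
      \<mu> \<odot> \<nu> = a \<odot> \<nu> \<odot> b)"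
    using assms
    by (intro conjI bexI[of _ \<mu>] bexI[of _ "src \<Lambda> \<nu>"]) (auto simp: rng_src src_closed fun_eq_iff)
next
  fix y assume "y \<in> Mor \<Lambda> \<and> (\<exists>a\<in>Mor \<Lambda>. \<exists>b\<in>Mor \<Lambda>. deg \<Lambda> a = deg \<Lambda> \<mu> \<and>
      deg \<Lambda> b = deg \<Lambda> (\<mu> \<odot> \<nu>) - deg \<Lambda> (\<mu> \<odot> \<nu>) \<and> src \<Lambda> a = rng \<Lambda> y \<and> src \<Lambda> y = rng \<Lambda> b \<and>
      \<mu> \<odot> \<nu> = a \<odot> y \<odot> b)"
  then obtain a b where y: "y \<in> Mor \<Lambda>" "a \<in> Mor \<Lambda>" "b \<in> Mor \<Lambda>" "deg \<Lambda> a = deg \<Lambda> \<mu>"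
    "deg \<Lambda> b = 0" "src \<Lambda> a = rng \<Lambda> y" "src \<Lambda> y = rng \<Lambda> b"
    "\<mu> \<odot> \<nu> = a \<odot> y \<odot> b" by (auto simp: fun_eq_iff)
  have "src \<Lambda> (a \<odot> y) = b" using y deg_0_unit[of b] by (simp add: src_cmp)
  then have e: "\<mu> \<odot> \<nu> = a \<odot> y" using y src_unit[of "a \<odot> y"] by (simp add: cmp_closed)
  have "deg \<Lambda> \<mu> + deg \<Lambda> \<nu> = deg \<Lambda> a + deg \<Lambda> y"
    using arg_cong[OF e, of "deg \<Lambda>"] deg_cmp[OF assms] deg_cmp[of a y] y(1,2,6) by simp
  then have "deg \<Lambda> \<nu> = deg \<Lambda> y" using y(4) by (auto simp: fun_eq_iff)
  then show "y = \<nu>" using factor_unique[of \<mu> \<nu> a y] assms y e by simp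
qed

end

text \<open>Here \<open>q\<close> is the linear part of \<open>f\<close>. From now on the matrix
  enters only through the additivity of \<open>q\<close>.\<close>

lemma affine_mapE:
  assumes "affine_map l k f"
  obtains q where "f 0 \<in> Nvec k" "q 0 = 0" "\<And>n. n \<in> Nvec l \<Longrightarrow> q n \<in> Nvec k"
    "\<And>n. n \<in> Nvec l \<Longrightarrow> f n = q n + f 0"
    "\<And>m n. m \<in> Nvec l \<Longrightarrow> n \<in> Nvec l \<Longrightarrow> q (m + n) = q m + q n"
proof -
  obtain A :: "nat \<Rightarrow> nat \<Rightarrow> nat" and p where p: "p \<in> Nvec k"
    and f: "\<forall>n \<in> Nvec l. f n = (\<lambda>i. if i < k then (\<Sum>j<l. A i j * n j) + p i else 0)"
    using assms unfolding affine_map_def by auto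
  show ?thesis
    by (rule that[of "\<lambda>n i. if i < k then (\<Sum>j<l. A i j * n j) else 0"])
      (use p f in \<open>auto simp: Nvec_def fun_eq_iff sum.distrib algebra_simps\<close>)
qed

locale pullback = k_graph k \<Lambda> for k :: nat and \<Lambda> :: "('a, 'm) kgraph_scheme" (structure) +
  fixes l :: nat and f q :: "(nat \<Rightarrow> nat) \<Rightarrow> nat \<Rightarrow> nat"
  assumes f_0: "f 0 \<in> Nvec k" and q_0: "q 0 = 0"
    and q_closed: "n \<in> Nvec l \<Longrightarrow> q n \<in> Nvec k"
    and f_q: "n \<in> Nvec l \<Longrightarrow> f n = q n + f 0"
    and q_add: "m \<in> Nvec l \<Longrightarrow> n \<in> Nvec l \<Longrightarrow> q (m + n) = q m + q n"
begin

abbreviation "P \<equiv> affine_pullback l f \<Lambda>"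

abbreviation "front x \<equiv> segment \<Lambda> x 0 (deg \<Lambda> x - f 0)"

lemma Mor_P: "(x, n) \<in> Mor P \<longleftrightarrow> x \<in> Mor \<Lambda> \<and> n \<in> Nvec l \<and> deg \<Lambda> x = q n + f 0"
  by (auto simp: affine_pullback_def Let_def f_q)

lemma
  assumes "\<mu> \<in> Mor \<Lambda>" "\<nu> \<in> Mor \<Lambda>" "src \<Lambda> \<mu> = rng \<Lambda> \<nu>" "deg \<Lambda> \<nu> = f 0"
  shows front_cmp: "front (\<mu> \<odot> \<nu>) = \<mu>" and src_P_cmp: "src P (\<mu> \<odot> \<nu>, n) = (\<nu>, 0)"
proof -
  have e: "deg \<Lambda> (\<mu> \<odot> \<nu>) - f 0 = deg \<Lambda> \<mu>" using assms by (simp add: deg_cmp fun_eq_iff)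
  show "front (\<mu> \<odot> \<nu>) = \<mu>" "src P (\<mu> \<odot> \<nu>, n) = (\<nu>, 0)"
    using e assms segment_initial[OF assms(1-3)] segment_final[OF assms(1-3)]
    by (auto simp: affine_pullback_def Let_def)
qed

lemma rng_P_cmp:
  assumes "\<mu> \<in> Mor \<Lambda>" "\<nu> \<in> Mor \<Lambda>" "src \<Lambda> \<mu> = rng \<Lambda> \<nu>" "deg \<Lambda> \<mu> = f 0"
  shows "rng P (\<mu> \<odot> \<nu>, n) = (\<mu>, 0)"
  using segment_initial[OF assms(1-3)] assms(4) by (auto simp: affine_pullback_def Let_def)

lemma cmp_P: "(x, m) \<odot>\<^bsub>P\<^esub> (y, n) = (front x \<odot> y, m + n)"
  by (simp add: affine_pullback_def Let_def)

text \<open>Vertices of the pullback are the morphisms of degree \<open>f 0\<close>. Cutting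
  \<open>x\<close> so that the last factor has this degree exposes its source;
  \<open>factor_front\<close> cuts the same \<open>x\<close> at the other end and exposes its
  range.\<close>

lemma factor_back:
  assumes "(x, n) \<in> Mor P"
  obtains \<mu> \<nu> where "\<mu> \<in> Mor \<Lambda>" "\<nu> \<in> Mor \<Lambda>" "deg \<Lambda> \<mu> = q n" "deg \<Lambda> \<nu> = f 0"
    "src \<Lambda> \<mu> = rng \<Lambda> \<nu>" "x = \<mu> \<odot> \<nu>" "front x = \<mu>" "src P (x, n) = (\<nu>, 0)"
  using assms by (auto simp: Mor_P f_0 q_closed front_cmp src_P_cmp elim: factor_ex[of x "q n" "f 0"])

lemma factor_front:
  assumes "(x, n) \<in> Mor P"
  obtains \<mu> \<nu> where "\<mu> \<in> Mor \<Lambda>" "\<nu> \<in> Mor \<Lambda>" "deg \<Lambda> \<mu> = f 0" "deg \<Lambda> \<nu> = q n"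
    "src \<Lambda> \<mu> = rng \<Lambda> \<nu>" "x = \<mu> \<odot> \<nu>" "rng P (x, n) = (\<mu>, 0)"
  using assms
  by (auto simp: Mor_P f_0 q_closed rng_P_cmp add.commute elim: factor_ex[of x "f 0" "q n"])

lemma unit_P:
  assumes "\<mu> \<in> Mor \<Lambda>" "deg \<Lambda> \<mu> = f 0"
  shows "(\<mu>, 0) \<in> Mor P" "src P (\<mu>, 0) = (\<mu>, 0)" "rng P (\<mu>, 0) = (\<mu>, 0)" "front \<mu> = rng \<Lambda> \<mu>"
  using assms src_P_cmp[of "rng \<Lambda> \<mu>" \<mu> 0] rng_P_cmp[of \<mu> "src \<Lambda> \<mu>" 0] front_cmp[of "rng \<Lambda> \<mu>" \<mu>]
  by (auto simp: Mor_P Nvec_0 q_0 rng_closed src_closed src_rng rng_src rng_unit src_unit)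

text \<open>Composable morphisms overlap: \<open>x = \<mu> \<odot> \<nu>\<close> and
  \<open>y = \<nu> \<odot> \<kappa>\<close> share a segment \<open>\<nu>\<close> of degree
  \<open>f 0\<close>, and their composite is \<open>\<mu> \<odot> \<nu> \<odot> \<kappa>\<close>.
  Regrouping it in two ways shows that it ends like \<open>y\<close> and begins like
  \<open>x\<close>.\<close>

lemma composable_P:
  assumes "(x, m) \<in> Mor P" "(y, n) \<in> Mor P" "src P (x, m) = rng P (y, n)"
  shows "front x \<in> Mor \<Lambda>" "src \<Lambda> (front x) = rng \<Lambda> y" "front (front x \<odot> y) = front x \<odot> front y"
    "front y \<in> Mor \<Lambda>" "src \<Lambda> (front x) = rng \<Lambda> (front y)"
    "(front x \<odot> y, m + n) \<in> Mor P" "src P (front x \<odot> y, m + n) = src P (y, n)"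
    "rng P (front x \<odot> y, m + n) = rng P (x, m)"
proof -
  obtain \<mu> \<nu> where x: "\<mu> \<in> Mor \<Lambda>" "\<nu> \<in> Mor \<Lambda>" "deg \<Lambda> \<mu> = q m" "deg \<Lambda> \<nu> = f 0"
    "src \<Lambda> \<mu> = rng \<Lambda> \<nu>" "x = \<mu> \<odot> \<nu>" "front x = \<mu>" "src P (x, m) = (\<nu>, 0)"
    using factor_back[OF assms(1)] .
  obtain \<xi> \<eta> where x': "\<xi> \<in> Mor \<Lambda>" "\<eta> \<in> Mor \<Lambda>" "deg \<Lambda> \<xi> = f 0" "deg \<Lambda> \<eta> = q m"
    "src \<Lambda> \<xi> = rng \<Lambda> \<eta>" "x = \<xi> \<odot> \<eta>" "rng P (x, m) = (\<xi>, 0)"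
    using factor_front[OF assms(1)] .
  obtain \<sigma> \<tau> where y: "\<sigma> \<in> Mor \<Lambda>" "\<tau> \<in> Mor \<Lambda>" "deg \<Lambda> \<sigma> = q n" "deg \<Lambda> \<tau> = f 0"
    "src \<Lambda> \<sigma> = rng \<Lambda> \<tau>" "y = \<sigma> \<odot> \<tau>" "front y = \<sigma>" "src P (y, n) = (\<tau>, 0)"
    using factor_back[OF assms(2)] .
  obtain \<rho> \<kappa> where y': "\<rho> \<in> Mor \<Lambda>" "\<kappa> \<in> Mor \<Lambda>" "deg \<Lambda> \<rho> = f 0" "deg \<Lambda> \<kappa> = q n"
    "src \<Lambda> \<rho> = rng \<Lambda> \<kappa>" "y = \<rho> \<odot> \<kappa>" "rng P (y, n) = (\<rho>, 0)"
    using factor_front[OF assms(2)] .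
  \<comment> \<open>Composability in the pullback says exactly that the last segment of
    \<open>x\<close> is the first segment of \<open>y\<close>.\<close>
  have \<rho>: "\<rho> = \<nu>" using assms(3) x y' by simp
  have r: "rng \<Lambda> y = src \<Lambda> \<mu>" using y' \<rho> x by (simp add: rng_cmp)
  have r': "rng \<Lambda> \<sigma> = src \<Lambda> \<mu>" using r y by (simp add: rng_cmp)
  have yM: "y \<in> Mor \<Lambda>" using assms(2) by (simp add: Mor_P)
  have s: "src \<Lambda> \<eta> = rng \<Lambda> \<kappa>"
  proof -
    have "src \<Lambda> (\<mu> \<odot> \<nu>) = src \<Lambda> (\<xi> \<odot> \<eta>)" using x(6) x'(6) by simp
    then show "src \<Lambda> \<eta> = rng \<Lambda> \<kappa>" using x x' y' \<rho> by (simp add: src_cmp)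
  qed
  \<comment> \<open>This grouping isolates the last segment \<open>\<tau>\<close> of
    \<open>y\<close> and so yields the source and the front of the composite.\<close>
  have 1: "\<mu> \<odot> y = (\<mu> \<odot> \<sigma>) \<odot> \<tau>" unfolding y(6) using x y r' by (intro cmp_assoc[symmetric]) auto
  \<comment> \<open>This grouping isolates the first segment \<open>\<xi>\<close> of
    \<open>x\<close> and so yields the range of the composite.\<close>
  have "\<mu> \<odot> y = (\<mu> \<odot> \<nu>) \<odot> \<kappa>" unfolding y'(6) \<rho> using x y' \<rho> by (intro cmp_assoc[symmetric]) auto
  also have "\<dots> = (\<xi> \<odot> \<eta>) \<odot> \<kappa>" using x(6) x'(6) by simp
  also have "\<dots> = \<xi> \<odot> (\<eta> \<odot> \<kappa>)" using x' y' s by (intro cmp_assoc) auto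
  finally have 2: "\<mu> \<odot> y = \<xi> \<odot> (\<eta> \<odot> \<kappa>)" .
  show "front x \<in> Mor \<Lambda>" "src \<Lambda> (front x) = rng \<Lambda> y" "front y \<in> Mor \<Lambda>"
    "src \<Lambda> (front x) = rng \<Lambda> (front y)"
    using x y r r' by auto
  have c: "\<mu> \<odot> \<sigma> \<in> Mor \<Lambda>" "src \<Lambda> (\<mu> \<odot> \<sigma>) = rng \<Lambda> \<tau>"
    using x y r' by (auto simp: cmp_closed src_cmp)
  have c': "\<eta> \<odot> \<kappa> \<in> Mor \<Lambda>" "src \<Lambda> \<xi> = rng \<Lambda> (\<eta> \<odot> \<kappa>)"
    using x' y' s by (auto simp: cmp_closed rng_cmp)
  show "front (front x \<odot> y) = front x \<odot> front y" "src P (front x \<odot> y, m + n) = src P (y, n)"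
    unfolding x(7) y(7) y(8) 1 using front_cmp src_P_cmp c y by auto
  show "rng P (front x \<odot> y, m + n) = rng P (x, m)"
    unfolding x(7) x'(7) 2 using rng_P_cmp c' x' by auto
  show "(front x \<odot> y, m + n) \<in> Mor P"
    using assms(1,2) x yM r by (auto simp: Mor_P Nvec_add cmp_closed deg_cmp q_add add.assoc)
qed

lemma category_P: "category P"
proof
  fix xm assume "xm \<in> Mor P"
  moreover obtain x m where xm: "xm = (x, m)" by fastforce
  ultimately have x: "(x, m) \<in> Mor P" by simp
  obtain \<mu> \<nu> where b: "\<mu> \<in> Mor \<Lambda>" "\<nu> \<in> Mor \<Lambda>" "deg \<Lambda> \<mu> = q m" "deg \<Lambda> \<nu> = f 0"
    "src \<Lambda> \<mu> = rng \<Lambda> \<nu>" "x = \<mu> \<odot> \<nu>" "front x = \<mu>" "src P (x, m) = (\<nu>, 0)"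
    using factor_back[OF x] .
  obtain \<xi> \<eta> where c: "\<xi> \<in> Mor \<Lambda>" "\<eta> \<in> Mor \<Lambda>" "deg \<Lambda> \<xi> = f 0" "deg \<Lambda> \<eta> = q m"
    "src \<Lambda> \<xi> = rng \<Lambda> \<eta>" "x = \<xi> \<odot> \<eta>" "rng P (x, m) = (\<xi>, 0)"
    using factor_front[OF x] .
  note u = unit_P[OF b(2,4)] unit_P[OF c(1,3)]
  show "src P xm \<in> Mor P" "rng P xm \<in> Mor P" "src P (src P xm) = src P xm"
    "rng P (src P xm) = src P xm" "src P (rng P xm) = rng P xm" "rng P (rng P xm) = rng P xm"
    unfolding xm b(8) c(7) by (fact u)+
  show "xm \<odot>\<^bsub>P\<^esub> src P xm = xm" using b by (simp add: xm cmp_P)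
  have "rng \<Lambda> \<xi> \<odot> x = x" using c rng_unit[of x] x by (simp add: Mor_P rng_cmp)
  then show "rng P xm \<odot>\<^bsub>P\<^esub> xm = xm" using u(8) c(7) by (simp add: xm cmp_P)
  fix yn assume "yn \<in> Mor P" and xy: "src P xm = rng P yn"
  moreover obtain y n where yn: "yn = (y, n)" by fastforce
  ultimately have y: "(y, n) \<in> Mor P" by simp
  note s = composable_P[OF x y xy[unfolded xm yn]]
  show "xm \<odot>\<^bsub>P\<^esub> yn \<in> Mor P" "src P (xm \<odot>\<^bsub>P\<^esub> yn) = src P yn" "rng P (xm \<odot>\<^bsub>P\<^esub> yn) = rng P xm"
    unfolding xm yn cmp_P by (fact s)+
  fix zo assume "zo \<in> Mor P" and yz: "src P yn = rng P zo"
  moreover obtain z j where zo: "zo = (z, j)" by fastforce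
  ultimately have z: "(z, j) \<in> Mor P" by simp
  note t = composable_P[OF y z yz[unfolded yn zo]]
  have "front x \<odot> front y \<odot> z = front x \<odot> (front y \<odot> z)"
    using s t z by (intro cmp_assoc) (auto simp: Mor_P)
  then show "xm \<odot>\<^bsub>P\<^esub> yn \<odot>\<^bsub>P\<^esub> zo = xm \<odot>\<^bsub>P\<^esub> (yn \<odot>\<^bsub>P\<^esub> zo)"
    using s(3) by (simp add: xm yn zo cmp_P add.assoc)
qed

text \<open>Dropping the final segment of length \<open>f 0\<close> is multiplicative, although \<open>(x, n) \<mapsto> x\<close> is not.\<close>

lemma is_functor_front: "is_functor P \<Lambda> (\<lambda>(x, n). front x)"
proof (rule functorI)
  fix xm assume "xm \<in> Mor P"
  moreover obtain x m where xm: "xm = (x, m)" by fastforce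
  ultimately have x: "(x, m) \<in> Mor P" by simp
  obtain \<mu> \<nu> where b: "\<mu> \<in> Mor \<Lambda>" "\<nu> \<in> Mor \<Lambda>" "deg \<Lambda> \<mu> = q m" "deg \<Lambda> \<nu> = f 0"
    "src \<Lambda> \<mu> = rng \<Lambda> \<nu>" "x = \<mu> \<odot> \<nu>" "front x = \<mu>" "src P (x, m) = (\<nu>, 0)"
    using factor_back[OF x] .
  obtain \<xi> \<eta> where c: "\<xi> \<in> Mor \<Lambda>" "\<eta> \<in> Mor \<Lambda>" "deg \<Lambda> \<xi> = f 0" "deg \<Lambda> \<eta> = q m"
    "src \<Lambda> \<xi> = rng \<Lambda> \<eta>" "x = \<xi> \<odot> \<eta>" "rng P (x, m) = (\<xi>, 0)"
    using factor_front[OF x] .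
  have "rng \<Lambda> (\<mu> \<odot> \<nu>) = rng \<Lambda> (\<xi> \<odot> \<eta>)" using b(6) c(6) by simp
  then show "(\<lambda>(x, n). front x) xm \<in> Mor \<Lambda>"
    "(\<lambda>(x, n). front x) (src P xm) = src \<Lambda> ((\<lambda>(x, n). front x) xm)"
    "(\<lambda>(x, n). front x) (rng P xm) = rng \<Lambda> ((\<lambda>(x, n). front x) xm)"
    unfolding xm using b c unit_P(4) by (auto simp: rng_cmp)
next
  fix xm yn assume "xm \<in> Mor P" "yn \<in> Mor P" "src P xm = rng P yn"
  then show "(\<lambda>(x, n). front x) (xm \<odot>\<^bsub>P\<^esub> yn) =
    (\<lambda>(x, n). front x) xm \<odot> (\<lambda>(x, n). front x) yn"
    by (cases xm, cases yn) (auto simp: cmp_P composable_P)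
qed

text \<open>The path \<open>x\<close> determines only \<open>q n\<close>, and \<open>q\<close> may
  fail to be injective; the component \<open>n\<close> is recovered by this cocycle.\<close>

lemma cocycle_deg_P: "cocycle P (Zgrp l) (\<lambda>(x, n). N_to_Z n)"
proof -
  have "N_to_Z n = 0" if "(x, n) \<in> Mor P" "rng P (x, n) = (x, n)" for x n
    using that by (elim factor_front) (simp add: N_to_Z_0)
  then show ?thesis
    by (auto simp: cocycle_def Obj_def Zgrp_def N_to_Z_0 N_to_Z_add N_to_Z_Zvec cmp_P)
      (simp add: Mor_P N_to_Z_Zvec)
qed

lemma inj_i_Pi_P:
  assumes "inj_on (i_Pi \<Lambda>) (Mor \<Lambda>)"
  shows "inj_on (i_Pi P) (Mor P)"
proof (rule inj_onI)
  interpret P: category P by (rule category_P)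
  fix xm yn assume "xm \<in> Mor P" "yn \<in> Mor P" and e: "i_Pi P xm = i_Pi P yn"
  moreover obtain x m y n where xy: "xm = (x, m)" "yn = (y, n)" by fastforce
  ultimately have x: "(x, m) \<in> Mor P" and y: "(y, n) \<in> Mor P" by simp_all
  note e = e[unfolded xy]
  have fr: "front x = front y"
    using P.i_Pi_eq_functor[OF e x category_axioms is_functor_front] assms x y
      functor_closed[OF is_functor_front] by (force simp: inj_on_def)
  have "src P (x, m) = src P (y, n)" by (rule P.i_Pi_eq_ends[OF e x])
  then have "x = y" using fr x y by (elim factor_back) simp
  moreover have "m = n"
    using P.i_Pi_eq_cocycle[OF e x group_Zgrp cocycle_deg_P] by (simp add: N_to_Z_inject)
  ultimately show "xm = yn" by (simp add: xy)
qed

end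

lemma inj_i_Pi_affine_pullback:
  assumes "k_graph k \<Lambda>" "inj_on (i_Pi \<Lambda>) (Mor \<Lambda>)" "affine_map l k f"
  shows "inj_on (i_Pi (affine_pullback l f \<Lambda>)) (Mor (affine_pullback l f \<Lambda>))"
proof -
  obtain q where "f 0 \<in> Nvec k" "q 0 = 0" "\<And>n. n \<in> Nvec l \<Longrightarrow> q n \<in> Nvec k"
    "\<And>n. n \<in> Nvec l \<Longrightarrow> f n = q n + f 0"
    "\<And>m n. m \<in> Nvec l \<Longrightarrow> n \<in> Nvec l \<Longrightarrow> q (m + n) = q m + q n"
    using affine_mapE[OF assms(3)] by metis
  then have "pullback k \<Lambda> l f q"
    using assms(1) by (simp add: pullback_def pullback_axioms_def)
  then show ?thesis using assms(2) by (rule pullback.inj_i_Pi_P)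
qed


section \<open>Products and skew products\<close>

lemma inj_i_Pi_prod_graph:
  assumes "category \<Lambda>" "category \<Gamma>"
    and "inj_on (i_Pi \<Lambda>) (Mor \<Lambda>)" "inj_on (i_Pi \<Gamma>) (Mor \<Gamma>)"
  shows "inj_on (i_Pi (prod_graph k \<Lambda> \<Gamma>)) (Mor (prod_graph k \<Lambda> \<Gamma>))"
proof -
  interpret L: category \<Lambda> by fact
  interpret G: category \<Gamma> by fact
  interpret P: category "prod_graph k \<Lambda> \<Gamma>"
    by unfold_locales
      (auto simp: prod_graph_def L.src_closed L.rng_closed L.src_src L.rng_src L.src_rng L.rng_rng
        L.cmp_closed L.src_cmp L.rng_cmp L.rng_unit L.src_unit L.cmp_assoc
        G.src_closed G.rng_closed G.src_src G.rng_src G.src_rng G.rng_rng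
        G.cmp_closed G.src_cmp G.rng_cmp G.rng_unit G.src_unit G.cmp_assoc)
  have F: "is_functor (prod_graph k \<Lambda> \<Gamma>) \<Lambda> fst" "is_functor (prod_graph k \<Lambda> \<Gamma>) \<Gamma> snd"
    by (auto simp: is_functor_def prod_graph_def)
  show ?thesis
  proof (rule inj_onI)
    fix x y assume x: "x \<in> Mor (prod_graph k \<Lambda> \<Gamma>)" "y \<in> Mor (prod_graph k \<Lambda> \<Gamma>)"
      and e: "i_Pi (prod_graph k \<Lambda> \<Gamma>) x = i_Pi (prod_graph k \<Lambda> \<Gamma>) y"
    have "fst x = fst y"
      using P.i_Pi_eq_functor[OF e x(1) assms(1) F(1)] assms(3) functor_closed[OF F(1)] x
      by (auto simp: inj_on_def)
    moreover have "snd x = snd y"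
      using P.i_Pi_eq_functor[OF e x(1) assms(2) F(2)] assms(4) functor_closed[OF F(2)] x
      by (auto simp: inj_on_def)
    ultimately show "x = y" by (rule prod_eqI)
  qed
qed

lemma inj_i_Pi_skew_product:
  assumes "category \<Lambda>" "inj_on (i_Pi \<Lambda>) (Mor \<Lambda>)" "group G" "cocycle \<Lambda> G c"
  shows "inj_on (i_Pi (skew_product G c \<Lambda>)) (Mor (skew_product G c \<Lambda>))"
proof -
  interpret L: category \<Lambda> by fact
  interpret G: group G by fact
  have c: "c x \<in> carrier G" "c (src \<Lambda> x) = \<one>\<^bsub>G\<^esub>" "c (rng \<Lambda> x) = \<one>\<^bsub>G\<^esub>"
    "y \<in> Mor \<Lambda> \<Longrightarrow> src \<Lambda> x = rng \<Lambda> y \<Longrightarrow> c (x \<odot>\<^bsub>\<Lambda>\<^esub> y) = c x \<otimes>\<^bsub>G\<^esub> c y"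
    if "x \<in> Mor \<Lambda>" for x y
    using assms(4) that L.src_Obj L.rng_Obj by (auto simp: cocycle_def)
  interpret P: category "skew_product G c \<Lambda>"
    by unfold_locales
      (auto simp: skew_product_def L.src_closed L.rng_closed L.src_src L.rng_src L.src_rng
        L.rng_rng L.cmp_closed L.src_cmp L.rng_cmp L.rng_unit L.src_unit L.cmp_assoc c G.m_assoc)
  have F: "is_functor (skew_product G c \<Lambda>) \<Lambda> snd"
    by (auto simp: is_functor_def skew_product_def)
  show ?thesis
  proof (rule inj_onI)
    fix x y assume x: "x \<in> Mor (skew_product G c \<Lambda>)" "y \<in> Mor (skew_product G c \<Lambda>)"
      and e: "i_Pi (skew_product G c \<Lambda>) x = i_Pi (skew_product G c \<Lambda>) y"
    have "snd x = snd y"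
      using P.i_Pi_eq_functor[OF e x(1) assms(1) F] assms(2) functor_closed[OF F] x
      by (auto simp: inj_on_def)
    \<comment> \<open>The group component is visible in the range
      \<open>(g, rng \<Lambda> x)\<close>, which the class determines.\<close>
    moreover have "fst x = fst y"
      using P.i_Pi_eq_ends(2)[OF e x(1)] by (auto simp: skew_product_def split: prod.splits)
    ultimately show "x = y" by (rule prod_eqI[rotated])
  qed
qed

section \<open>Automorphism groups and the fundamental groupoid\<close>

text \<open>Each law holds after applying \<open>\<phi>\<close>, and \<open>\<phi>\<close> is
  injective. The restriction is there because inverses in \<open>BijGroup\<close> are
  extensional.\<close>

lemma functor_inv_into:
  assumes "category C" "is_functor C C \<phi>" "\<phi> \<in> Bij (Mor C)"
  shows "is_functor C C (\<lambda>x \<in> Mor C. inv_into (Mor C) \<phi> x)"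
proof -
  interpret category C by fact
  let ?\<psi> = "inv_into (Mor C) \<phi>"
  have bij: "bij_betw \<phi> (Mor C) (Mor C)" using assms(3) by (simp add: Bij_def)
  have \<psi>: "?\<psi> x \<in> Mor C" "\<phi> (?\<psi> x) = x" if "x \<in> Mor C" for x
    using Bij_inv_into_mem[OF assms(3) that] bij_betw_inv_into_right[OF bij that] by auto
  have \<psi>_eq: "?\<psi> y = x" if "x \<in> Mor C" "\<phi> x = y" for x y
    using bij_betw_inv_into_left[OF bij that(1)] that(2) by simp
  have s: "?\<psi> (src C x) = src C (?\<psi> x)" "?\<psi> (rng C x) = rng C (?\<psi> x)" if "x \<in> Mor C" for x
    using that \<psi> functor_src[OF assms(2)] functor_rng[OF assms(2)]
    by (auto intro!: \<psi>_eq simp: src_closed rng_closed)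
  show ?thesis
  proof (rule functorI)
    fix x y assume xy: "x \<in> Mor C" "y \<in> Mor C" "src C x = rng C y"
    then have "src C (?\<psi> x) = rng C (?\<psi> y)" using s by metis
    then have "?\<psi> (x \<odot>\<^bsub>C\<^esub> y) = ?\<psi> x \<odot>\<^bsub>C\<^esub> ?\<psi> y"
      using xy \<psi> functor_cmp[OF assms(2)] by (intro \<psi>_eq) (auto simp: cmp_closed)
    then show "(\<lambda>x \<in> Mor C. ?\<psi> x) (x \<odot>\<^bsub>C\<^esub> y) =
        (\<lambda>x \<in> Mor C. ?\<psi> x) x \<odot>\<^bsub>C\<^esub> (\<lambda>x \<in> Mor C. ?\<psi> x) y"
      using xy by (simp add: cmp_closed)
  qed (use \<psi> s in \<open>auto simp: src_closed rng_closed\<close>)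
qed

lemma functor_compose:
  assumes "category C" "is_functor C C \<phi>" "is_functor C C \<psi>"
  shows "is_functor C C (compose (Mor C) \<phi> \<psi>)"
proof -
  interpret category C by fact
  show ?thesis
    using functor_comp[OF assms(3,2)]
    by (auto simp: is_functor_def compose_def src_closed rng_closed cmp_closed Pi_iff)
qed

lemma functor_id: "category C \<Longrightarrow> is_functor C C (\<lambda>x \<in> Mor C. x)"
  by (auto simp: is_functor_def category.src_closed category.rng_closed category.cmp_closed)

lemma subgroup_Aut_cat:
  assumes "category C"
  shows "subgroup {\<phi> \<in> Bij (Mor C). is_functor C C \<phi>} (BijGroup (Mor C))"
  by unfold_locales
    (auto simp: BijGroup_def compose_Bij id_Bij functor_compose functor_id assms
      inv_BijGroup[unfolded BijGroup_def] restrict_inv_into_Bij functor_inv_into)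

lemma subgroup_Aut_kgraph:
  assumes "category \<Lambda>"
  shows "subgroup {\<phi> \<in> Bij (Mor \<Lambda>). is_functor \<Lambda> \<Lambda> \<phi> \<and> (\<forall>x \<in> Mor \<Lambda>. deg \<Lambda> (\<phi> x) = deg \<Lambda> x)}
    (BijGroup (Mor \<Lambda>))"
proof -
  have d: "deg \<Lambda> (inv_into (Mor \<Lambda>) \<phi> x) = deg \<Lambda> x"
    if "\<phi> \<in> Bij (Mor \<Lambda>)" "\<forall>x \<in> Mor \<Lambda>. deg \<Lambda> (\<phi> x) = deg \<Lambda> x" "x \<in> Mor \<Lambda>" for \<phi> x
    using that Bij_inv_into_mem[OF that(1,3)]
    by (metis (mono_tags, lifting) Bij_def Int_iff bij_betw_inv_into_right mem_Collect_eq)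
  show ?thesis
    by unfold_locales
      (auto simp: BijGroup_def compose_Bij id_Bij functor_compose functor_id assms compose_eq
        functor_closed inv_BijGroup[unfolded BijGroup_def] restrict_inv_into_Bij
        functor_inv_into d)
qed

lemma group_Aut_cat: "category C \<Longrightarrow> group (Aut_cat C)"
  unfolding Aut_cat_def by (intro subgroup.subgroup_is_group subgroup_Aut_cat group_BijGroup)

lemma Aut_catD:
  assumes "\<phi> \<in> carrier (Aut_cat C)"
  shows "\<phi> \<in> Bij (Mor C)" "is_functor C C \<phi>"
  using assms by (auto simp: Aut_cat_def)

lemma Aut_cat_mult:
  assumes "\<phi> \<in> carrier (Aut_cat C)" "\<psi> \<in> carrier (Aut_cat C)"
  shows "\<phi> \<otimes>\<^bsub>Aut_cat C\<^esub> \<psi> = compose (Mor C) \<phi> \<psi>"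
  using assms by (simp add: Aut_cat_def BijGroup_def)

lemma Aut_cat_one: "\<one>\<^bsub>Aut_cat C\<^esub> = (\<lambda>x \<in> Mor C. x)"
  by (simp add: Aut_cat_def BijGroup_def)

text \<open>Both groups are subgroups of \<open>BijGroup (Mor \<Lambda>)\<close>, hence share
  products and inverses. This allows the inverse in the definition of \<open>crossed_product\<close>
  to be computed in \<open>Aut_cat \<Lambda>\<close>.\<close>

lemma Aut_kgraph_sub:
  assumes "category \<Lambda>"
  shows "carrier (Aut_kgraph \<Lambda>) \<subseteq> carrier (Aut_cat \<Lambda>)" "mult (Aut_kgraph \<Lambda>) = mult (Aut_cat \<Lambda>)"
    and "\<phi> \<in> carrier (Aut_kgraph \<Lambda>) \<Longrightarrow> inv\<^bsub>Aut_kgraph \<Lambda>\<^esub> \<phi> = inv\<^bsub>Aut_cat \<Lambda>\<^esub> \<phi>"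
  using group.m_inv_consistent[OF group_BijGroup subgroup_Aut_kgraph[OF assms], of \<phi>]
    group.m_inv_consistent[OF group_BijGroup subgroup_Aut_cat[OF assms], of \<phi>]
  by (auto simp: Aut_kgraph_def Aut_cat_def)

lemma (in groupoid) cancel_right:
  assumes "x \<in> Mor C" "y \<in> Mor C" "z \<in> Mor C" "src C x = rng C z" "src C y = rng C z"
    and "x \<odot> z = y \<odot> z"
  shows "x = y"
proof -
  have "w \<odot> z \<odot> ginv C z = w" if "w \<in> Mor C" "src C w = rng C z" for w
    using that assms(3) src_unit[of w] by (simp add: cmp_assoc ginv)
  from this[OF assms(1,4)] this[OF assms(2,5)] show ?thesis unfolding assms(6) by simp
qed

section \<open>Homomorphisms out of the fundamental groupoid, and its functoriality\<close>

context category
begin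

text \<open>Both functors are evaluation of terms at the same generators. Unlike the uniqueness in
  \<open>induces\<close>, this asks for no extensionality and can be applied pointwise.\<close>

lemma functor_Pi_unique:
  assumes "groupoid G" "is_functor (Pi_gpd C) G H" "is_functor (Pi_gpd C) G K"
    and "\<And>x. x \<in> Mor C \<Longrightarrow> H (i_Pi C x) = K (i_Pi C x)" and "X \<in> Mor (Pi_gpd C)"
  shows "H X = K X"
proof -
  have F: "is_functor C G (\<lambda>x. K (i_Pi C x))" by (rule functor_comp[OF is_functor_i_Pi assms(3)])
  obtain t where "wt C t" "X = tclass C t" using assms(5) by (auto simp: Mor_Pi)
  then show ?thesis
    using functor_Pi_eq_teval[OF assms(1) F assms(2,4)] functor_Pi_eq_teval[OF assms(1) F assms(3)]
    by simp
qed

lemma induced_hom: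
  fixes G :: "'g cat"
  assumes "groupoid G" "is_functor C G F"
  shows "induced_hom C G F \<in> extensional (Mor (Pi_gpd C))" "is_functor (Pi_gpd C) G (induced_hom C G F)"
    "\<And>x. x \<in> Mor C \<Longrightarrow> induced_hom C G F (i_Pi C x) = F x"
proof -
  have "induces C (Pi_gpd C) (i_Pi C) G F (induced_hom C G F)"
    unfolding induced_hom_def
    by (rule theI'[OF fundamental_groupoidD[OF fundamental_groupoid_Pi assms]])
  then show "induced_hom C G F \<in> extensional (Mor (Pi_gpd C))"
    "is_functor (Pi_gpd C) G (induced_hom C G F)"
    "\<And>x. x \<in> Mor C \<Longrightarrow> induced_hom C G F (i_Pi C x) = F x"
    by (auto simp: induces_def)
qed

text \<open>This is structural induction on representing terms; the class of \<open>Invs t\<close>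
  is the chosen inverse \<open>ginv\<close> by uniqueness of inverses.\<close>

lemma Pi_induct [consumes 1, case_names gen cmp inverse]:
  assumes "X \<in> Mor (Pi_gpd C)"
    and gen: "\<And>x. x \<in> Mor C \<Longrightarrow> Q (i_Pi C x)"
    and cmp: "\<And>X Y. X \<in> Mor (Pi_gpd C) \<Longrightarrow> Y \<in> Mor (Pi_gpd C) \<Longrightarrow>
      src (Pi_gpd C) X = rng (Pi_gpd C) Y \<Longrightarrow> Q X \<Longrightarrow> Q Y \<Longrightarrow> Q (X \<odot>\<^bsub>Pi_gpd C\<^esub> Y)"
    and inv: "\<And>X. X \<in> Mor (Pi_gpd C) \<Longrightarrow> Q X \<Longrightarrow> Q (ginv (Pi_gpd C) X)"
  shows "Q X"
proof -
  have "Q (tclass C t)" if "wt C t" for t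
    using that
  proof (induction t)
    case (Gen x)
    then show ?case using gen[of x] by (simp add: i_Pi_def)
  next
    case (Mult t u)
    then show ?case using cmp[of "tclass C t" "tclass C u"]
      by (simp add: cmp_Pi tclass_Mor src_Pi rng_Pi)
  next
    case (Invs t)
    then have t: "wt C t" and i: "wt C (Invs t)" by auto
    have "tclass C (Invs t) = ginv (Pi_gpd C) (tclass C t)"
      using t i src_Pi[OF i] rng_Pi[OF i] teq_tclass[OF teq_inv_left[OF t]]
      by (intro groupoid.ginv_unique[OF groupoid_Pi])
        (auto simp: tclass_Mor src_Pi rng_Pi cmp_Pi)
    then show ?case using inv[of "tclass C t"] Invs t by (simp add: tclass_Mor)
  qed
  then show ?thesis using assms(1) by (auto simp: Mor_Pi)
qed

text \<open>Naturality squares of \<open>\<tau>\<close> from \<open>B\<close> to \<open>A\<close>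
  paste along composites. The square at an inverse arises from the given one by multiplying with the
  inverse of \<open>A X\<close> on the left and that of \<open>B X\<close> on the right. Hence it
  suffices to check generators.\<close>

lemma natural_Pi:
  assumes "groupoid G" and A: "is_functor (Pi_gpd C) G A" and B: "is_functor (Pi_gpd C) G B"
    and \<tau>: "\<And>w. w \<in> Obj (Pi_gpd C) \<Longrightarrow> \<tau> w \<in> Mor G \<and> src G (\<tau> w) = B w \<and> rng G (\<tau> w) = A w"
    and gen: "\<And>x. x \<in> Mor C \<Longrightarrow> A (i_Pi C x) \<odot>\<^bsub>G\<^esub> \<tau> (i_Pi C (src C x)) =
      \<tau> (i_Pi C (rng C x)) \<odot>\<^bsub>G\<^esub> B (i_Pi C x)"
    and "X \<in> Mor (Pi_gpd C)"
  shows "A X \<odot>\<^bsub>G\<^esub> \<tau> (src (Pi_gpd C) X) = \<tau> (rng (Pi_gpd C) X) \<odot>\<^bsub>G\<^esub> B X"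
proof -
  interpret G: groupoid G by fact
  interpret P: groupoid "Pi_gpd C" by (rule groupoid_Pi)
  let ?P = "Pi_gpd C"
  note A' = functor_closed[OF A] functor_src[OF A, symmetric] functor_rng[OF A, symmetric]
    and B' = functor_closed[OF B] functor_src[OF B, symmetric] functor_rng[OF B, symmetric]
  have \<tau>': "\<tau> (src ?P X) \<in> Mor G" "\<tau> (rng ?P X) \<in> Mor G"
    "src G (\<tau> (src ?P X)) = B (src ?P X)" "src G (\<tau> (rng ?P X)) = B (rng ?P X)"
    "rng G (\<tau> (src ?P X)) = A (src ?P X)" "rng G (\<tau> (rng ?P X)) = A (rng ?P X)"
    if "X \<in> Mor ?P" for X
    using \<tau> P.src_Obj[OF that] P.rng_Obj[OF that] by auto
  show ?thesis
    using assms(6)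
  proof (induction rule: Pi_induct)
    case (gen x)
    then show ?case using assms(5) functor_src[OF is_functor_i_Pi] functor_rng[OF is_functor_i_Pi]
      by metis
  next
    case (cmp X Y)
    let ?a = "A X" and ?b = "A Y" and ?c = "B X" and ?d = "B Y"
    have "A (X \<odot>\<^bsub>?P\<^esub> Y) \<odot>\<^bsub>G\<^esub> \<tau> (src ?P (X \<odot>\<^bsub>?P\<^esub> Y)) = ?a \<odot>\<^bsub>G\<^esub> (?b \<odot>\<^bsub>G\<^esub> \<tau> (src ?P Y))"
      using cmp(1-3) by (simp add: functor_cmp[OF A] P.src_cmp A' \<tau>' G.cmp_assoc)
    also have "\<dots> = ?a \<odot>\<^bsub>G\<^esub> \<tau> (src ?P X) \<odot>\<^bsub>G\<^esub> ?d"
      unfolding cmp(5) using cmp(1-3) by (simp add: A' B' \<tau>' G.cmp_assoc)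
    also have "\<dots> = \<tau> (rng ?P X) \<odot>\<^bsub>G\<^esub> (?c \<odot>\<^bsub>G\<^esub> ?d)"
      unfolding cmp(4) using cmp(1-3) by (simp add: A' B' \<tau>' G.cmp_assoc)
    also have "\<dots> = \<tau> (rng ?P (X \<odot>\<^bsub>?P\<^esub> Y)) \<odot>\<^bsub>G\<^esub> B (X \<odot>\<^bsub>?P\<^esub> Y)"
      using cmp by (simp add: functor_cmp[OF B] P.rng_cmp)
    finally show ?case .
  next
    case (inverse X)
    let ?Y = "ginv ?P X"
    note g = P.ginv[OF inverse(1)]
    have 1: "A ?Y \<odot>\<^bsub>G\<^esub> A X = A (src ?P X)" "B X \<odot>\<^bsub>G\<^esub> B ?Y = B (rng ?P X)"
      using functor_cmp[OF A g(1) inverse(1)] functor_cmp[OF B inverse(1) g(1)] g by auto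
    have "\<tau> (src ?P X) \<odot>\<^bsub>G\<^esub> B ?Y = A ?Y \<odot>\<^bsub>G\<^esub> A X \<odot>\<^bsub>G\<^esub> \<tau> (src ?P X) \<odot>\<^bsub>G\<^esub> B ?Y"
      unfolding 1 using inverse(1) G.rng_unit[OF \<tau>'(1)[OF inverse(1)]] by (simp add: \<tau>')
    also have "\<dots> = A ?Y \<odot>\<^bsub>G\<^esub> (A X \<odot>\<^bsub>G\<^esub> \<tau> (src ?P X)) \<odot>\<^bsub>G\<^esub> B ?Y"
      using inverse(1) g by (simp add: A' \<tau>' G.cmp_assoc)
    also have "\<dots> = A ?Y \<odot>\<^bsub>G\<^esub> (\<tau> (rng ?P X) \<odot>\<^bsub>G\<^esub> B X) \<odot>\<^bsub>G\<^esub> B ?Y"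
      by (simp only: inverse(2))
    also have "\<dots> = A ?Y \<odot>\<^bsub>G\<^esub> (\<tau> (rng ?P X) \<odot>\<^bsub>G\<^esub> (B X \<odot>\<^bsub>G\<^esub> B ?Y))"
      using inverse(1) g by (simp add: A' B' \<tau>' G.cmp_assoc G.cmp_closed G.rng_cmp G.src_cmp)
    also have "\<dots> = A ?Y \<odot>\<^bsub>G\<^esub> \<tau> (rng ?P X)"
      unfolding 1 using inverse(1) G.src_unit[OF \<tau>'(2)[OF inverse(1)]] by (simp add: \<tau>')
    finally show ?case using g by simp
  qed
qed

definition Pi_map :: "('a \<Rightarrow> 'a) \<Rightarrow> 'a gterm set \<Rightarrow> 'a gterm set" where
  "Pi_map \<phi> = induced_hom C (Pi_gpd C) (\<lambda>x. i_Pi C (\<phi> x))"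

lemma Pi_map:
  assumes "is_functor C C \<phi>"
  shows "Pi_map \<phi> \<in> extensional (Mor (Pi_gpd C))" "is_functor (Pi_gpd C) (Pi_gpd C) (Pi_map \<phi>)"
    "\<And>x. x \<in> Mor C \<Longrightarrow> Pi_map \<phi> (i_Pi C x) = i_Pi C (\<phi> x)"
  unfolding Pi_map_def by (rule induced_hom[OF groupoid_Pi functor_comp[OF assms is_functor_i_Pi]])+

text \<open>Both sides are extensional homomorphisms that take the class of \<open>x\<close> to the
  class of \<open>\<phi> (\<psi> x)\<close>, so they agree everywhere.\<close>

lemma Pi_map_compose:
  assumes "is_functor C C \<phi>" "is_functor C C \<psi>"
  shows "Pi_map (compose (Mor C) \<phi> \<psi>) = compose (Mor (Pi_gpd C)) (Pi_map \<phi>) (Pi_map \<psi>)"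
proof (rule extensionalityI[of _ "Mor (Pi_gpd C)"])
  note c = functor_compose[OF category_axioms assms]
  show "Pi_map (compose (Mor C) \<phi> \<psi>) \<in> extensional (Mor (Pi_gpd C))" by (rule Pi_map[OF c])
  have P: "category (Pi_gpd C)" using groupoid_Pi by (simp add: groupoid_def)
  fix X assume X: "X \<in> Mor (Pi_gpd C)"
  show "Pi_map (compose (Mor C) \<phi> \<psi>) X = compose (Mor (Pi_gpd C)) (Pi_map \<phi>) (Pi_map \<psi>) X"
    by (rule functor_Pi_unique[OF groupoid_Pi Pi_map(2)[OF c]
          functor_compose[OF P Pi_map(2)[OF assms(1)] Pi_map(2)[OF assms(2)]] _ X])
      (use assms c in \<open>simp add: Pi_map compose_eq functor_closed[OF is_functor_i_Pi] functor_closed\<close>)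
qed simp

lemma Pi_map_id: "Pi_map (\<lambda>x \<in> Mor C. x) = (\<lambda>X \<in> Mor (Pi_gpd C). X)"
proof (rule extensionalityI[of _ "Mor (Pi_gpd C)"])
  note c = functor_id[OF category_axioms]
  have P: "category (Pi_gpd C)" using groupoid_Pi by (simp add: groupoid_def)
  show "Pi_map (\<lambda>x \<in> Mor C. x) \<in> extensional (Mor (Pi_gpd C))" by (rule Pi_map[OF c])
  fix X assume X: "X \<in> Mor (Pi_gpd C)"
  show "Pi_map (\<lambda>x \<in> Mor C. x) X = (\<lambda>X \<in> Mor (Pi_gpd C). X) X"
    by (rule functor_Pi_unique[OF groupoid_Pi Pi_map(2)[OF c] functor_id[OF P] _ X])
      (use c in \<open>simp add: Pi_map functor_closed[OF is_functor_i_Pi]\<close>)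
qed simp

text \<open>By functoriality, the inverse of \<open>Pi_map \<phi>\<close> is \<open>Pi_map\<close>
  of the inverse of \<open>\<phi>\<close>.\<close>

lemma Pi_map_Aut:
  assumes "\<phi> \<in> carrier (Aut_cat C)"
  shows "Pi_map \<phi> \<in> carrier (Aut_cat (Pi_gpd C))"
proof -
  interpret A: group "Aut_cat C" by (rule group_Aut_cat) (rule category_axioms)
  let ?\<psi> = "inv\<^bsub>Aut_cat C\<^esub> \<phi>"
  have \<psi>: "?\<psi> \<in> carrier (Aut_cat C)" using assms by simp
  note f = Aut_catD(2)[OF assms] Aut_catD(2)[OF \<psi>]
  have c: "compose (Mor (Pi_gpd C)) (Pi_map \<phi>) (Pi_map ?\<psi>) = (\<lambda>X \<in> Mor (Pi_gpd C). X)"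
    "compose (Mor (Pi_gpd C)) (Pi_map ?\<psi>) (Pi_map \<phi>) = (\<lambda>X \<in> Mor (Pi_gpd C). X)"
    unfolding Pi_map_compose[OF f, symmetric] Pi_map_compose[OF f(2,1), symmetric]
      Aut_cat_mult[OF assms \<psi>, symmetric] Aut_cat_mult[OF \<psi> assms, symmetric]
      A.r_inv[OF assms] A.l_inv[OF assms] Aut_cat_one Pi_map_id by (rule refl)+
  have "Pi_map \<phi> (Pi_map ?\<psi> X) = X" "Pi_map ?\<psi> (Pi_map \<phi> X) = X" if "X \<in> Mor (Pi_gpd C)" for X
    using fun_cong[OF c(1), of X] fun_cong[OF c(2), of X] that by (simp_all add: compose_eq)
  then have "bij_betw (Pi_map \<phi>) (Mor (Pi_gpd C)) (Mor (Pi_gpd C))"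
    using functor_closed[OF Pi_map(2)[OF f(1)]] functor_closed[OF Pi_map(2)[OF f(2)]]
    by (intro bij_betwI[of _ _ _ "Pi_map ?\<psi>"]) auto
  then show ?thesis
    using Pi_map[OF f(1)] by (simp add: Aut_cat_def Bij_def)
qed

text \<open>Composed with an action on \<open>C\<close>, this gives the induced action on
  \<open>Pi_gpd C\<close>.\<close>

lemma Pi_map_hom: "Pi_map \<in> hom (Aut_cat C) (Aut_cat (Pi_gpd C))"
  by (rule homI) (simp_all add: Pi_map_Aut Aut_cat_mult Pi_map_compose Aut_catD)

end

section \<open>Extension of cocycles from natural to integer vectors\<close>

lemma Zvec_0: "0 \<in> Zvec l"
  and Zvec_add: "m \<in> Zvec l \<Longrightarrow> n \<in> Zvec l \<Longrightarrow> m + n \<in> Zvec l"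
  and Zvec_minus: "m \<in> Zvec l \<Longrightarrow> - m \<in> Zvec l"
  by (auto simp: Zvec_def)

lemma Zvec_difference:
  assumes "z \<in> Zvec l"
  obtains m n where "m \<in> Nvec l" "n \<in> Nvec l" "z + N_to_Z n = N_to_Z m"
proof
  show "(\<lambda>i. nat (z i)) \<in> Nvec l" "(\<lambda>i. nat (- z i)) \<in> Nvec l"
    "z + N_to_Z (\<lambda>i. nat (- z i)) = N_to_Z (\<lambda>i. nat (z i))"
    using assms by (auto simp: Zvec_def Nvec_def N_to_Z_def fun_eq_iff)
qed

text \<open>The value at \<open>z = m - n\<close> has to be \<open>F v m \<odot> (F (act (- z) v) n)\<^sup>-\<^sup>1\<close>; the point is that this
  does not depend on the choice of \<open>m\<close> and \<open>n\<close>.\<close>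

lemma (in groupoid) cocycle_extend:
  assumes act: "\<And>z v. z \<in> Zvec l \<Longrightarrow> v \<in> V \<Longrightarrow> act z v \<in> V"
    "\<And>v. v \<in> V \<Longrightarrow> act 0 v = v"
    "\<And>z w v. z \<in> Zvec l \<Longrightarrow> w \<in> Zvec l \<Longrightarrow> v \<in> V \<Longrightarrow> act (z + w) v = act z (act w v)"
    and F: "\<And>v n. v \<in> V \<Longrightarrow> n \<in> Nvec l \<Longrightarrow> F v n \<in> Mor C"
    "\<And>v n. v \<in> V \<Longrightarrow> n \<in> Nvec l \<Longrightarrow> rng C (F v n) = ob v"
    "\<And>v n. v \<in> V \<Longrightarrow> n \<in> Nvec l \<Longrightarrow> src C (F v n) = ob (act (- N_to_Z n) v)"
    "\<And>v m n. v \<in> V \<Longrightarrow> m \<in> Nvec l \<Longrightarrow> n \<in> Nvec l \<Longrightarrow>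
      F v (m + n) = F v m \<odot> F (act (- N_to_Z m) v) n"
  obtains U where
    "\<And>v z. v \<in> V \<Longrightarrow> z \<in> Zvec l \<Longrightarrow> U v z \<in> Mor C"
    "\<And>v z. v \<in> V \<Longrightarrow> z \<in> Zvec l \<Longrightarrow> rng C (U v z) = ob v"
    "\<And>v z. v \<in> V \<Longrightarrow> z \<in> Zvec l \<Longrightarrow> src C (U v z) = ob (act (- z) v)"
    "\<And>v z w. v \<in> V \<Longrightarrow> z \<in> Zvec l \<Longrightarrow> w \<in> Zvec l \<Longrightarrow> U v (z + w) = U v z \<odot> U (act (- z) v) w"
    "\<And>v n. v \<in> V \<Longrightarrow> n \<in> Nvec l \<Longrightarrow> U v (N_to_Z n) = F v n"
proof -
  have act': "act (- z) v \<in> V" "act (- (z + w)) v = act (- w) (act (- z) v)"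
    if "z \<in> Zvec l" "w \<in> Zvec l" "v \<in> V" for z w v
    using that act(1)[of "- z"] act(3)[of "- w" "- z" v] minus_add[of z w]
    by (simp_all add: Zvec_minus add.commute)
  \<comment> \<open>\<open>R\<close> says that \<open>u\<close> is the right value at
    \<open>z\<close> as computed from the representation \<open>z = m - n\<close>; multiplying by
    \<open>F (act (- z) v) n\<close> avoids writing an inverse.\<close>
  define R where "R v z u m n \<longleftrightarrow> u \<in> Mor C \<and> rng C u = ob v \<and> src C u = ob (act (- z) v) \<and>
    m \<in> Nvec l \<and> n \<in> Nvec l \<and> z + N_to_Z n = N_to_Z m \<and> u \<odot> F (act (- z) v) n = F v m"
    for v z u m n
  have shift: "R v z u (m + j) (n + j)"
    if "R v z u m n" "v \<in> V" "z \<in> Zvec l" "j \<in> Nvec l" for v z u m n j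
  proof -
    let ?w = "act (- z) v" and ?y = "act (- N_to_Z m) v"
    have r: "u \<in> Mor C" "rng C u = ob v" "src C u = ob ?w" "m \<in> Nvec l" "n \<in> Nvec l"
      "z + N_to_Z n = N_to_Z m" "u \<odot> F ?w n = F v m"
      using that(1) by (auto simp: R_def)
    have w: "?w \<in> V" "?y \<in> V" "act (- N_to_Z n) ?w = ?y"
      using that r act'[of z "N_to_Z n" v] act'(1)[of "N_to_Z m" 0 v]
      by (auto simp: N_to_Z_Zvec Zvec_0)
    \<comment> \<open>Going \<open>m\<close> steps from \<open>v\<close> and \<open>n\<close> steps
      from \<open>?w\<close> leads to the same point \<open>?y\<close>, so both sides are prolonged
      by the same factor \<open>F ?y j\<close>.\<close>
    have "u \<odot> F ?w (n + j) = u \<odot> F ?w n \<odot> F ?y j"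
      using that(2,4) r(1-6) w by (simp add: F cmp_assoc)
    also have "\<dots> = F v (m + j)" unfolding r(7) using that(2,4) r(4) by (simp add: F)
    finally show ?thesis
      using r that(4) by (auto simp: R_def Nvec_add N_to_Z_add add.assoc[symmetric])
  qed
  have unique: "u = u'"
    if "R v z u m n" "R v z u' m' n'" "v \<in> V" "z \<in> Zvec l" for v z u u' m n m' n'
  proof -
    have n: "m \<in> Nvec l" "n \<in> Nvec l" "m' \<in> Nvec l" "n' \<in> Nvec l"
      "z + N_to_Z n = N_to_Z m" "z + N_to_Z n' = N_to_Z m'"
      using that by (auto simp: R_def)
    \<comment> \<open>Since addition of vectors commutes, any two representations can be shifted to
      a common one, where \<open>cancel_right\<close> compares the values.\<close>
    have "N_to_Z (m + n') = N_to_Z (m' + n)"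
      unfolding N_to_Z_add n(5)[symmetric] n(6)[symmetric] by (simp add: algebra_simps)
    then have e: "m + n' = m' + n" by (simp add: N_to_Z_inject)
    have "R v z u (m + n') (n + n')" "R v z u' (m + n') (n + n')"
      using shift[OF that(1,3,4) n(4)] shift[OF that(2,3,4) n(2)] e
      by (simp_all add: add.commute)
    then show ?thesis
      using that(3,4) act'(1)[of z 0 v]
      by (intro cancel_right[of u u' "F (act (- z) v) (n + n')"])
        (auto simp: R_def F Zvec_0)
  qed
  have ex: "\<exists>u m n. R v z u m n" if "v \<in> V" and z: "z \<in> Zvec l" for v z
  proof -
    obtain m n where n: "m \<in> Nvec l" "n \<in> Nvec l" "z + N_to_Z n = N_to_Z m"
      using Zvec_difference[OF z] .
    let ?w = "act (- z) v"
    have w: "?w \<in> V" "act (- N_to_Z n) ?w = act (- N_to_Z m) v"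
      using that n act'[of z "N_to_Z n" v] by (auto simp: N_to_Z_Zvec)
    note g = ginv[OF F(1)[OF w(1) n(2)]]
    have "R v z (F v m \<odot> ginv C (F ?w n)) m n"
      using that n w g src_unit[OF F(1)[OF that(1) n(1)]]
      by (auto simp: R_def F cmp_closed rng_cmp src_cmp cmp_assoc)
    then show ?thesis by blast
  qed
  \<comment> \<open>By \<open>unique\<close>, the choice made here does not depend on the
    representation.\<close>
  define U where "U v z = (SOME u. \<exists>m n. R v z u m n)" for v z
  have U: "\<exists>m n. R v z (U v z) m n" if "v \<in> V" "z \<in> Zvec l" for v z
    unfolding U_def by (rule someI_ex[OF ex[OF that]])
  have U_eq: "U v z = u" if "R v z u m n" "v \<in> V" "z \<in> Zvec l" for v z u m n
    using U[OF that(2,3)] unique that by blast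
  show thesis
  proof (rule that[of U])
    fix v z assume v: "v \<in> V" and z: "z \<in> Zvec l"
    then show t: "U v z \<in> Mor C" "rng C (U v z) = ob v" "src C (U v z) = ob (act (- z) v)"
      using U[of v z] by (auto simp: R_def)
    fix w assume w: "w \<in> Zvec l"
    let ?v = "act (- z) v" and ?y = "act (- (z + w)) v"
    have v': "?v \<in> V" "act (- w) ?v = ?y" "?y \<in> V"
      using act'[OF z w v] act'(1)[of "z + w" 0 v] z w v by (auto simp: Zvec_add Zvec_0)
    obtain m n where R1: "R v z (U v z) m n" using U[OF v z] by blast
    obtain m' n' where R2: "R ?v w (U ?v w) m' n'" using U[OF v'(1) w] by blast
    have n: "m \<in> Nvec l" "n \<in> Nvec l" "m' \<in> Nvec l" "n' \<in> Nvec l"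
      "z + N_to_Z n = N_to_Z m" "w + N_to_Z n' = N_to_Z m'"
      using R1 R2 by (auto simp: R_def)
    \<comment> \<open>The representations are shifted until they telescope:
      \<open>z = (m + m') - (m' + n)\<close> and \<open>w = (m' + n) - (n' + n)\<close>.\<close>
    have R: "R v z (U v z) (m + m') (m' + n)" "R ?v w (U ?v w) (m' + n) (n' + n)"
      using shift[OF R1 v z n(3)] shift[OF R2 v'(1) w n(2)] by (simp_all add: add.commute)
    have e: "z + w + N_to_Z (n' + n) = N_to_Z (m + m')"
      unfolding N_to_Z_add n(5)[symmetric] n(6)[symmetric] by (simp add: algebra_simps)
    have "U v z \<odot> U ?v w \<odot> F ?y (n' + n) = U v z \<odot> (U ?v w \<odot> F ?y (n' + n))"
      using R v' n by (intro cmp_assoc) (auto simp: R_def F(1-3) Nvec_add)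
    also have "\<dots> = F v (m + m')" using R v'(2) by (simp add: R_def)
    finally have "U v z \<odot> U ?v w \<odot> F ?y (n' + n) = F v (m + m')" .
    then have "R v (z + w) (U v z \<odot> U ?v w) (m + m') (n' + n)"
      using R v' n e by (auto simp: R_def cmp_closed rng_cmp src_cmp Nvec_add)
    then show "U v (z + w) = U v z \<odot> U ?v w" using v z w by (intro U_eq) (auto simp: Zvec_add)
  next
    fix v n assume v: "v \<in> V" and n: "n \<in> Nvec l"
    \<comment> \<open>With \<open>n\<close> represented as \<open>n - 0\<close>, the defining
      equation is the cocycle identity for \<open>n + 0\<close>.\<close>
    have "R v (N_to_Z n) (F v n) n 0"
      using F(4)[OF v n Nvec_0] F(1-3)[OF v n] n by (auto simp: R_def N_to_Z_0 Nvec_0)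
    then show "U v (N_to_Z n) = F v n" using v n by (intro U_eq) (auto simp: N_to_Z_Zvec)
  qed
qed

text \<open>A homomorphism into a group is a cocycle over a single vertex, so this is
  \<open>cocycle_extend\<close> for the one-object groupoid \<open>group_cat H\<close>.\<close>

lemma hom_Nmon_extend:
  assumes "group H" "a \<in> hom (Nmon l) H"
  obtains b where "b \<in> hom (Zgrp l) H" "\<And>n. n \<in> Nvec l \<Longrightarrow> b (N_to_Z n) = a n"
proof -
  interpret H: group H by fact
  interpret G: groupoid "group_cat H" by (rule groupoid_group_cat) fact
  obtain U where "\<And>v z. v \<in> {()} \<Longrightarrow> z \<in> Zvec l \<Longrightarrow> U v z \<in> Mor (group_cat H)"
    "\<And>v z w. v \<in> {()} \<Longrightarrow> z \<in> Zvec l \<Longrightarrow> w \<in> Zvec l \<Longrightarrow>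
      U v (z + w) = U v z \<odot>\<^bsub>group_cat H\<^esub> U () w"
    "\<And>v n. v \<in> {()} \<Longrightarrow> n \<in> Nvec l \<Longrightarrow> U v (N_to_Z n) = a n"
    by (rule G.cocycle_extend[of l "{()}" "\<lambda>_ _. ()" "\<lambda>_. a" "\<lambda>_. \<one>\<^bsub>H\<^esub>"])
      (use assms(2) in \<open>auto simp: hom_def Nmon_def group_cat_def\<close>)
  then show thesis
    by (intro that[of "U ()"]) (auto simp: hom_def Zgrp_def group_cat_def)
qed

section \<open>Crossed products and semidirect products\<close>

text \<open>Each law is an equation in \<open>C\<close> whose image under \<open>F\<close> holds in
  \<open>D\<close>, and injectivity reflects it. The predicate \<open>is_functor\<close> makes sense
  before \<open>C\<close> is known to be a category.\<close>

lemma category_embed: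
  assumes "category D" and F: "is_functor C D F" and inj: "inj_on F (Mor C)"
    and closed: "\<And>x. x \<in> Mor C \<Longrightarrow> src C x \<in> Mor C" "\<And>x. x \<in> Mor C \<Longrightarrow> rng C x \<in> Mor C"
    "\<And>x y. x \<in> Mor C \<Longrightarrow> y \<in> Mor C \<Longrightarrow> src C x = rng C y \<Longrightarrow> x \<odot>\<^bsub>C\<^esub> y \<in> Mor C"
  shows "category C"
proof -
  interpret D: category D by fact
  note f = functor_src[OF F] functor_rng[OF F] functor_cmp[OF F] functor_closed[OF F]
  have s: "src C (src C x) = src C x" "rng C (src C x) = src C x"
    "src C (rng C x) = rng C x" "rng C (rng C x) = rng C x" if "x \<in> Mor C" for x
    using that
    by (auto intro!: inj_onD[OF inj] simp: closed f D.src_src D.rng_src D.src_rng D.rng_rng)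
  have e: "src D (F x) = rng D (F y)" if "x \<in> Mor C" "y \<in> Mor C" "src C x = rng C y" for x y
    using that f by metis
  have c: "src C (x \<odot>\<^bsub>C\<^esub> y) = src C y" "rng C (x \<odot>\<^bsub>C\<^esub> y) = rng C x"
    if "x \<in> Mor C" "y \<in> Mor C" "src C x = rng C y" for x y
    using that e[OF that] by (auto intro!: inj_onD[OF inj] simp: closed f D.src_cmp D.rng_cmp)
  show ?thesis
  proof
    fix x assume x: "x \<in> Mor C"
    show "rng C x \<odot>\<^bsub>C\<^esub> x = x" "x \<odot>\<^bsub>C\<^esub> src C x = x"
      using x s[OF x] closed f D.rng_unit D.src_unit by (auto intro!: inj_onD[OF inj])
    fix y z assume y: "y \<in> Mor C" "z \<in> Mor C" "src C x = rng C y" "src C y = rng C z"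
    show "x \<odot>\<^bsub>C\<^esub> y \<odot>\<^bsub>C\<^esub> z = x \<odot>\<^bsub>C\<^esub> (y \<odot>\<^bsub>C\<^esub> z)"
      using x y c e by (intro inj_onD[OF inj]) (auto simp: closed f D.cmp_assoc)
  qed (auto simp: closed s c)
qed

section \<open>Actions of integer vectors and their semidirect products\<close>

locale Z_action = category C for C :: "('a, 'm) cat_scheme" (structure) +
  fixes l :: nat and \<beta> :: "(nat \<Rightarrow> int) \<Rightarrow> 'a \<Rightarrow> 'a"
  assumes \<beta>_hom: "\<beta> \<in> hom (Zgrp l) (Aut_cat C)"
begin

lemma \<beta>_Aut: "z \<in> Zvec l \<Longrightarrow> \<beta> z \<in> carrier (Aut_cat C)"
  using \<beta>_hom by (auto simp: hom_def Zgrp_def)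

lemmas \<beta>_functor = Aut_catD(2)[OF \<beta>_Aut]

lemmas \<beta>_closed = functor_closed[OF \<beta>_functor]
  and \<beta>_src = functor_src[OF \<beta>_functor]
  and \<beta>_rng = functor_rng[OF \<beta>_functor]
  and \<beta>_cmp = functor_cmp[OF \<beta>_functor]

lemma \<beta>_hom_add: "z \<in> Zvec l \<Longrightarrow> w \<in> Zvec l \<Longrightarrow> \<beta> (z + w) = \<beta> z \<otimes>\<^bsub>Aut_cat C\<^esub> \<beta> w"
  using \<beta>_hom by (auto simp: hom_def Zgrp_def)

lemma \<beta>_add:
  "z \<in> Zvec l \<Longrightarrow> w \<in> Zvec l \<Longrightarrow> x \<in> Mor C \<Longrightarrow> \<beta> (z + w) x = \<beta> z (\<beta> w x)"
  by (simp add: \<beta>_hom_add Aut_cat_mult \<beta>_Aut compose_eq)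

lemma \<beta>_hom_0: "\<beta> 0 = \<one>\<^bsub>Aut_cat C\<^esub>"
  using hom_one[OF \<beta>_hom group_Zgrp group_Aut_cat[OF category_axioms]] by (simp add: Zgrp_def)

lemma \<beta>_0: "x \<in> Mor C \<Longrightarrow> \<beta> 0 x = x"
  by (simp add: \<beta>_hom_0 Aut_cat_one)

lemma \<beta>_hom_minus: "z \<in> Zvec l \<Longrightarrow> \<beta> (- z) = inv\<^bsub>Aut_cat C\<^esub> (\<beta> z)"
  using \<beta>_hom_add[of "- z" z] group_Aut_cat[OF category_axioms]
  by (intro group.inv_equality[symmetric]) (auto simp: Zvec_minus \<beta>_hom_0 \<beta>_Aut)

lemma \<beta>_minus:
  "z \<in> Zvec l \<Longrightarrow> x \<in> Mor C \<Longrightarrow> \<beta> z (\<beta> (- z) x) = x"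
  "z \<in> Zvec l \<Longrightarrow> x \<in> Mor C \<Longrightarrow> \<beta> (- z) (\<beta> z x) = x"
  using \<beta>_add[of z "- z" x] \<beta>_add[of "- z" z x] by (simp_all add: Zvec_minus \<beta>_0)

lemma \<beta>_minus_add:
  "z \<in> Zvec l \<Longrightarrow> w \<in> Zvec l \<Longrightarrow> x \<in> Mor C \<Longrightarrow> \<beta> (- (z + w)) x = \<beta> (- w) (\<beta> (- z) x)"
  using \<beta>_add[of "- w" "- z" x] minus_add[of z w] by (simp add: Zvec_minus add.commute)

lemma \<beta>_Obj: "z \<in> Zvec l \<Longrightarrow> v \<in> Obj C \<Longrightarrow> \<beta> z v \<in> Obj C"
  by (auto simp: Obj_def \<beta>_closed \<beta>_rng[symmetric])

abbreviation "S \<equiv> semidirect_product l C \<beta>"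

lemma S_simps:
  "Mor S = Mor C \<times> Zvec l" "src S (x, z) = (\<beta> (- z) (src C x), 0)" "rng S (x, z) = (rng C x, 0)"
  "(x, z) \<odot>\<^bsub>S\<^esub> (y, w) = (x \<odot> \<beta> z y, z + w)"
  by (simp_all add: semidirect_product_def)

text \<open>Applying \<open>\<beta> z\<close> moves the action from the source of \<open>x\<close>
  to \<open>y\<close>, which turns composability in \<open>S\<close> into the condition under which
  \<open>x \<odot> \<beta> z y\<close> is formed in \<open>C\<close>.\<close>

lemma S_composable:
  assumes "x \<in> Mor C" "z \<in> Zvec l" "y \<in> Mor C"
  shows "\<beta> (- z) (src C x) = rng C y \<longleftrightarrow> src C x = rng C (\<beta> z y)"
  using assms \<beta>_minus[of z "src C x"] \<beta>_minus[of z "rng C y"]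
  by (auto simp: \<beta>_rng[symmetric] src_closed rng_closed)

lemma category_S: "category S"
proof (standard, goal_cases)
  \<comment> \<open>Associativity is treated apart because it needs the composability of the
    translated pair \<open>\<beta> z y\<close> and \<open>\<beta> z (\<beta> w u)\<close>.\<close>
  case (12 a b c)
  then obtain x z y w u t where a: "a = (x, z)" "b = (y, w)" "c = (u, t)"
    by (metis surj_pair)
  have h: "x \<in> Mor C" "y \<in> Mor C" "u \<in> Mor C" "z \<in> Zvec l" "w \<in> Zvec l" "t \<in> Zvec l"
    "src C x = rng C (\<beta> z y)" "src C y = rng C (\<beta> w u)"
    using 12 by (auto simp: a S_simps S_composable)
  have "src C (\<beta> z y) = rng C (\<beta> z (\<beta> w u))"
    using h by (simp add: \<beta>_src[symmetric] \<beta>_rng[symmetric] \<beta>_closed)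
  then show ?case
    using h by (simp add: a S_simps \<beta>_add \<beta>_cmp \<beta>_closed cmp_assoc add.assoc)
qed (auto simp: S_simps src_closed rng_closed \<beta>_closed Zvec_minus Zvec_0 Zvec_add \<beta>_src[symmetric]
    \<beta>_rng[symmetric] src_src rng_src src_rng rng_rng \<beta>_0 S_composable cmp_closed src_cmp rng_cmp
    \<beta>_minus_add \<beta>_minus rng_unit src_unit simp del: minus_add_distrib)

text \<open>Solving \<open>(x, z) (y, w) = (rng C x, 0)\<close> gives \<open>w = - z\<close> and
  \<open>y = \<beta> (- z) (ginv C x)\<close>.\<close>

lemma groupoid_S:
  assumes "groupoid C"
  shows "groupoid S"
proof (intro groupoid.intro category_S groupoid_axioms.intro)
  interpret groupoid C by fact
  fix a assume "a \<in> Mor S"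
  then obtain x z where a: "a = (x, z)" "x \<in> Mor C" "z \<in> Zvec l" by (auto simp: S_simps)
  note g = ginv[OF a(2)]
  have "\<beta> (- z) (ginv C x) \<odot> \<beta> (- z) x = src C (\<beta> (- z) x)"
    using \<beta>_cmp[of "- z" "ginv C x" x] \<beta>_src[of "- z" x] g a by (simp add: Zvec_minus)
  then show "\<exists>b \<in> Mor S. rng S b = src S a \<and> src S b = rng S a \<and>
      a \<odot>\<^bsub>S\<^esub> b = rng S a \<and> b \<odot>\<^bsub>S\<^esub> a = src S a"
    using a g
    by (intro bexI[of _ "(\<beta> (- z) (ginv C x), - z)"])
      (auto simp: S_simps \<beta>_src[symmetric] \<beta>_rng[symmetric] \<beta>_minus \<beta>_closed Zvec_minus
        src_closed rng_closed)
qed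

lemma Z_action_Pi: "Z_action (Pi_gpd C) l (\<lambda>z. Pi_map (\<beta> z))"
  using hom_compose[OF \<beta>_hom Pi_map_hom] groupoid_Pi
  by (simp add: Z_action_def Z_action_axioms_def groupoid_def comp_def)

end

text \<open>The action \<open>\<beta>\<close> is an extension of \<open>\<alpha>\<close> to integer
  vectors. The second assumption lets sources in \<open>crossed_product\<close>, defined by a group
  inverse, be expressed through \<open>\<beta>\<close>. The same locale \<open>Z_action\<close> is
  then used again for the induced action \<open>\<gamma>\<close> on
  \<open>Pi_gpd \<Lambda>\<close>.\<close>

locale crossed = Z_action \<Lambda> l \<beta>
  for \<Lambda> :: "('a, 'm) kgraph_scheme" (structure) and l :: nat and \<beta> +
  fixes k :: nat and \<alpha> :: "(nat \<Rightarrow> nat) \<Rightarrow> 'a \<Rightarrow> 'a"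
  assumes \<alpha>_\<beta>: "n \<in> Nvec l \<Longrightarrow> \<alpha> n = \<beta> (N_to_Z n)"
    and inv_\<alpha>: "n \<in> Nvec l \<Longrightarrow> inv\<^bsub>Aut_kgraph \<Lambda>\<^esub> (\<alpha> n) = \<beta> (- N_to_Z n)"
begin

abbreviation "X \<equiv> crossed_product k l \<Lambda> \<alpha>"
abbreviation "\<gamma> \<equiv> \<lambda>z. Pi_map (\<beta> z)"
abbreviation "Q \<equiv> semidirect_product l (Pi_gpd \<Lambda>) \<gamma>"
abbreviation "J \<equiv> map_prod (i_Pi \<Lambda>) N_to_Z"

sublocale Pi: Z_action "Pi_gpd \<Lambda>" l \<gamma>
  by (rule Z_action_Pi)

sublocale Pi: groupoid "Pi_gpd \<Lambda>"
  by (rule groupoid_Pi)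

sublocale Q: groupoid Q
  by (rule Pi.groupoid_S) (rule groupoid_Pi)

lemma X_simps:
  "Mor X = Mor \<Lambda> \<times> Nvec l" "rng X (x, m) = (rng \<Lambda> x, 0)"
  "m \<in> Nvec l \<Longrightarrow> src X (x, m) = (\<beta> (- N_to_Z m) (src \<Lambda> x), 0)"
  "m \<in> Nvec l \<Longrightarrow> (x, m) \<odot>\<^bsub>X\<^esub> (y, n) = (x \<odot> \<beta> (N_to_Z m) y, m + n)"
  by (simp_all add: crossed_product_def inv_\<alpha>) (simp add: \<alpha>_\<beta>)

text \<open>The crossed product sits inside \<open>S\<close>, the semidirect product of
  \<open>\<Lambda>\<close> itself with the integer vectors, and inherits its laws.\<close>

lemma category_X: "category X"
proof (rule category_embed[OF category_S])
  show "is_functor X S (map_prod (\<lambda>x. x) N_to_Z)"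
    by (auto simp: is_functor_def X_simps S_simps N_to_Z_Zvec N_to_Z_add N_to_Z_0)
  show "inj_on (map_prod (\<lambda>x. x) N_to_Z) (Mor X)"
    by (auto simp: inj_on_def N_to_Z_inject)
qed (auto simp: X_simps src_closed rng_closed \<beta>_closed Zvec_minus N_to_Z_Zvec Nvec_0 Nvec_add
    S_composable cmp_closed)

sublocale X: category X
  by (rule category_X)

lemmas i_simps = functor_closed[OF is_functor_i_Pi] functor_src[OF is_functor_i_Pi]
  functor_rng[OF is_functor_i_Pi] functor_cmp[OF is_functor_i_Pi]

lemma \<gamma>_i: "z \<in> Zvec l \<Longrightarrow> x \<in> Mor \<Lambda> \<Longrightarrow> \<gamma> z (i_Pi \<Lambda> x) = i_Pi \<Lambda> (\<beta> z x)"
  by (rule Pi_map(3)[OF \<beta>_functor])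

lemma is_functor_J: "is_functor X Q J"
  by (auto simp: is_functor_def X_simps Pi.S_simps N_to_Z_Zvec N_to_Z_add N_to_Z_0 Zvec_minus
      i_simps \<gamma>_i[symmetric] \<beta>_closed S_composable src_closed)

lemma Obj_X: "Obj X = Obj \<Lambda> \<times> {0}"
  by (auto simp: Obj_def X_simps Nvec_0)

lemma Obj_Q: "Obj Q = Obj (Pi_gpd \<Lambda>) \<times> {0}"
  by (auto simp: Obj_def Pi.S_simps Zvec_0)

lemma J_Obj: "J ` Obj X = Obj Q"
  unfolding Obj_X Obj_Q i_Pi_Obj[symmetric] by (force simp: N_to_Z_0)

text \<open>The image of \<open>J\<close> generates \<open>Q\<close> as a groupoid:
  \<open>(g, z)\<close> is \<open>(g, 0)\<close> times a vertex element
  \<open>(i_Pi \<Lambda> v, z)\<close>. The first factor is settled by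
  \<open>functor_Pi_unique\<close>, the second by cancellation.\<close>

lemma functor_Q_unique:
  assumes "groupoid G" and H: "is_functor Q G H" and K: "is_functor Q G K"
    and eq: "\<And>a. a \<in> Mor X \<Longrightarrow> H (J a) = K (J a)" and "a \<in> Mor Q"
  shows "H a = K a"
proof -
  interpret G: groupoid G by fact
  obtain g z where a: "a = (g, z)" "g \<in> Mor (Pi_gpd \<Lambda>)" "z \<in> Zvec l"
    using assms(5) by (auto simp: Pi.S_simps)
  have J0: "is_functor (Pi_gpd \<Lambda>) Q (\<lambda>g. (g, 0))"
    by (auto simp: is_functor_def Pi.S_simps Zvec_0 Pi.\<beta>_0 Pi.src_closed)
  have 1: "H (g, 0) = K (g, 0)"
  proof (rule functor_Pi_unique[OF assms(1) functor_comp[OF J0 H] functor_comp[OF J0 K] _ a(2)])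
    fix x assume "x \<in> Mor \<Lambda>"
    then show "H (i_Pi \<Lambda> x, 0) = K (i_Pi \<Lambda> x, 0)"
      using eq[of "(x, 0)"] by (simp add: X_simps Nvec_0 N_to_Z_0)
  qed
  obtain v where v: "v \<in> Obj \<Lambda>" "src (Pi_gpd \<Lambda>) g = i_Pi \<Lambda> v"
    using Pi.src_Obj[OF a(2)] unfolding i_Pi_Obj[symmetric] by auto
  note vM = ObjD[OF v(1)]
  obtain m n where n: "m \<in> Nvec l" "n \<in> Nvec l" "z + N_to_Z n = N_to_Z m"
    using Zvec_difference[OF a(3)] .
  \<comment> \<open>The element \<open>?c\<close> is chosen so that \<open>?b\<close> times
    \<open>J ?c\<close> is \<open>J (v, m)\<close>; thus \<open>?b\<close> is a quotient of two
    elements of the image of \<open>J\<close>.\<close>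
  let ?b = "(i_Pi \<Lambda> v, z)" and ?c = "(\<beta> (- z) v, n)"
  have b: "?b \<in> Mor Q" "?c \<in> Mor X" "J ?c \<in> Mor Q" "src Q ?b = rng Q (J ?c)"
    "?b \<odot>\<^bsub>Q\<^esub> J ?c = J (v, m)" "(v, m) \<in> Mor X"
    using vM a(3) n functor_rng[OF is_functor_i_Pi, of "\<beta> (- z) v"]
      functor_src[OF is_functor_i_Pi, of v] functor_cmp[OF is_functor_i_Pi, of v v]
      rng_unit[of v]
    by (auto simp: Pi.S_simps X_simps i_simps(1) Zvec_minus \<beta>_closed \<gamma>_i N_to_Z_Zvec \<beta>_minus
        \<beta>_rng[symmetric])
  have "H ?b \<odot>\<^bsub>G\<^esub> H (J ?c) = K ?b \<odot>\<^bsub>G\<^esub> H (J ?c)"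
    using functor_cmp[OF H b(1,3,4)] functor_cmp[OF K b(1,3,4)] eq[OF b(2)] eq[OF b(6)] b(5) by simp
  moreover have "src G (H ?b) = rng G (H (J ?c))" "src G (K ?b) = rng G (H (J ?c))"
    using functor_src[OF H b(1)] functor_src[OF K b(1)] functor_rng[OF H b(3)]
      functor_rng[OF K b(3)] b(4) eq[OF b(2)] by metis+
  ultimately have 2: "H ?b = K ?b"
    using functor_closed[OF H] functor_closed[OF K] b(1,3)
    by (intro G.cancel_right[of "H ?b" "K ?b" "H (J ?c)"]) auto
  have d: "(g, 0) \<in> Mor Q" "src Q (g, 0) = rng Q ?b" "(g, 0) \<odot>\<^bsub>Q\<^esub> ?b = a"
    using a v vM Pi.src_unit[of g] Pi.rng_src[of g]
    by (auto simp: Pi.S_simps Zvec_0 Pi.\<beta>_0 i_simps(1) i_simps(3)[symmetric])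
  show ?thesis
    using functor_cmp[OF H d(1) b(1) d(2)] functor_cmp[OF K d(1) b(1) d(2)] 1 2 d(3) by simp
qed

text \<open>A functor on the crossed product restricts to a functor on \<open>\<Lambda>\<close> and to a cocycle on the
  vertices, which extend separately to \<open>Pi_gpd \<Lambda>\<close> and to integer vectors; the extensions can be
  combined because the cocycle is a natural transformation, and that is checked on generators.\<close>

lemma functor_Q_ex:
  fixes G :: "'g cat"
  assumes "groupoid G" and F: "is_functor X G F"
  obtains H where "is_functor Q G H" "\<And>a. a \<in> Mor X \<Longrightarrow> H (J a) = F a"
proof -
  interpret G: groupoid G by fact
  note F' = functor_closed[OF F] functor_src[OF F, symmetric] functor_rng[OF F, symmetric]
    functor_cmp[OF F, symmetric]
  have "is_functor \<Lambda> X (\<lambda>x. (x, 0))"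
    by (auto simp: is_functor_def X_simps Nvec_0 N_to_Z_0 \<beta>_0 src_closed)
  from functor_comp[OF this F] have F1: "is_functor \<Lambda> G (\<lambda>x. F (x, 0))" .
  define H1 where "H1 = induced_hom \<Lambda> G (\<lambda>x. F (x, 0))"
  note H1 = induced_hom(2,3)[OF assms(1) F1, folded H1_def]
  note H1' = functor_closed[OF H1(1)] functor_src[OF H1(1), symmetric]
    functor_rng[OF H1(1), symmetric] functor_cmp[OF H1(1)]
  have act: "\<beta> (- N_to_Z n) v \<in> Obj \<Lambda>" "\<beta> (- N_to_Z n) v \<in> Mor \<Lambda>"
    if "v \<in> Obj \<Lambda>" "n \<in> Nvec l" for v n
    using \<beta>_Obj[OF _ that(1), of "- N_to_Z n"] that ObjD(1) by (auto simp: Zvec_minus N_to_Z_Zvec)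
  \<comment> \<open>\<open>U v z\<close> is to be the value of the extension at
    \<open>(i_Pi \<Lambda> v, z)\<close>.\<close>
  obtain U where U:
    "\<And>v z. v \<in> Obj \<Lambda> \<Longrightarrow> z \<in> Zvec l \<Longrightarrow> U v z \<in> Mor G"
    "\<And>v z. v \<in> Obj \<Lambda> \<Longrightarrow> z \<in> Zvec l \<Longrightarrow> rng G (U v z) = F (v, 0)"
    "\<And>v z. v \<in> Obj \<Lambda> \<Longrightarrow> z \<in> Zvec l \<Longrightarrow> src G (U v z) = F (\<beta> (- z) v, 0)"
    "\<And>v z w. v \<in> Obj \<Lambda> \<Longrightarrow> z \<in> Zvec l \<Longrightarrow> w \<in> Zvec l \<Longrightarrow>
      U v (z + w) = U v z \<odot>\<^bsub>G\<^esub> U (\<beta> (- z) v) w"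
    "\<And>v n. v \<in> Obj \<Lambda> \<Longrightarrow> n \<in> Nvec l \<Longrightarrow> U v (N_to_Z n) = F (v, n)"
  proof (rule G.cocycle_extend[of l "Obj \<Lambda>" \<beta> "\<lambda>v n. F (v, n)" "\<lambda>v. F (v, 0)"])
    fix v m n assume v: "v \<in> Obj \<Lambda>" and n: "m \<in> Nvec l" "n \<in> Nvec l"
    let ?w = "\<beta> (- N_to_Z m) v"
    have "(v, m + n) = (v, m) \<odot>\<^bsub>X\<^esub> (?w, n)" "src X (v, m) = rng X (?w, n)"
      using v n ObjD[OF v] ObjD[OF act(1)[OF v n(1)]] rng_unit[of v]
      by (auto simp: X_simps \<beta>_minus N_to_Z_Zvec)
    then show "F (v, m + n) = F (v, m) \<odot>\<^bsub>G\<^esub> F (?w, n)"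
      using v n ObjD[OF v] act(2)[OF v n(1)] by (simp add: F' X_simps)
  qed (auto simp: \<beta>_Obj \<beta>_0 \<beta>_add ObjD F' X_simps)
  \<comment> \<open>Exchange law for generators, modelled on \<open>(x, 0) (src \<Lambda> x, z) =
    (rng \<Lambda> x, z) (\<beta> (- z) x, 0)\<close>. This is an identity in the crossed product
    only for natural \<open>z\<close>.\<close>
  have nat: "F (x, 0) \<odot>\<^bsub>G\<^esub> U (src \<Lambda> x) z = U (rng \<Lambda> x) z \<odot>\<^bsub>G\<^esub> F (\<beta> (- z) x, 0)"
    if x: "x \<in> Mor \<Lambda>" and z: "z \<in> Zvec l" for x z
  proof -
    have N: "F (x, 0) \<odot>\<^bsub>G\<^esub> U (src \<Lambda> x) (N_to_Z n) =
      U (rng \<Lambda> x) (N_to_Z n) \<odot>\<^bsub>G\<^esub> F (\<beta> (- N_to_Z n) x, 0)"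
      if x: "x \<in> Mor \<Lambda>" and n: "n \<in> Nvec l" for x n
    proof -
      have y: "\<beta> (- N_to_Z n) x \<in> Mor \<Lambda>" using x n by (simp add: \<beta>_closed Zvec_minus N_to_Z_Zvec)
      have "(x, 0) \<odot>\<^bsub>X\<^esub> (src \<Lambda> x, n) = (rng \<Lambda> x, n) \<odot>\<^bsub>X\<^esub> (\<beta> (- N_to_Z n) x, 0)"
        using x n
        by (simp add: X_simps Nvec_0 N_to_Z_0 N_to_Z_Zvec \<beta>_0 \<beta>_minus src_closed src_unit rng_unit)
      moreover have "src X (x, 0) = rng X (src \<Lambda> x, n)"
        "src X (rng \<Lambda> x, n) = rng X (\<beta> (- N_to_Z n) x, 0)"
        using x n by (simp_all add: X_simps Nvec_0 N_to_Z_0 N_to_Z_Zvec Zvec_minus \<beta>_0 src_closed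
            rng_src src_rng \<beta>_rng[symmetric])
      ultimately show ?thesis
        using x n y functor_cmp[OF F, of "(x, 0)" "(src \<Lambda> x, n)"]
          functor_cmp[OF F, of "(rng \<Lambda> x, n)" "(\<beta> (- N_to_Z n) x, 0)"]
        by (simp add: U(5) src_Obj rng_Obj X_simps src_closed rng_closed Nvec_0)
    qed
    obtain m n where n: "m \<in> Nvec l" "n \<in> Nvec l" "z + N_to_Z n = N_to_Z m"
      using Zvec_difference[OF z] .
    let ?y = "\<beta> (- z) x"
    let ?u = "U (src \<Lambda> ?y) (N_to_Z n)"
    note Z = Zvec_minus[OF z] N_to_Z_Zvec[OF n(1)] N_to_Z_Zvec[OF n(2)]
    have y: "?y \<in> Mor \<Lambda>" "src \<Lambda> ?y = \<beta> (- z) (src \<Lambda> x)" "rng \<Lambda> ?y = \<beta> (- z) (rng \<Lambda> x)"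
      "\<beta> (- N_to_Z n) ?y = \<beta> (- N_to_Z m) x"
      using x z n \<beta>_minus_add[of z "N_to_Z n" x] by (simp_all add: \<beta>_closed \<beta>_src \<beta>_rng Z)
    have y': "\<beta> (- N_to_Z n) ?y \<in> Mor \<Lambda>"
      "rng \<Lambda> (\<beta> (- N_to_Z n) ?y) = \<beta> (- N_to_Z n) (rng \<Lambda> ?y)"
      using y(1) by (simp_all add: \<beta>_closed \<beta>_rng Zvec_minus Z)
    have o: "src \<Lambda> x \<in> Obj \<Lambda>" "rng \<Lambda> x \<in> Obj \<Lambda>" "src \<Lambda> ?y \<in> Obj \<Lambda>" "rng \<Lambda> ?y \<in> Obj \<Lambda>"
      using x y(1) by (simp_all add: src_Obj rng_Obj)
    have x0: "F (w, 0) \<in> Mor G" "src G (F (w, 0)) = F (src \<Lambda> w, 0)"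
      "rng G (F (w, 0)) = F (rng \<Lambda> w, 0)" if "w \<in> Mor \<Lambda>" for w
      using that functor_closed[OF F1] functor_src[OF F1] functor_rng[OF F1] by auto
    \<comment> \<open>For \<open>z = m - n\<close>, multiplication by \<open>?u\<close> turns
      \<open>U\<close> at \<open>z\<close> into \<open>U\<close> at \<open>m\<close>. The natural
      case is then used for \<open>x\<close> with \<open>m\<close> and for \<open>?y\<close> with
      \<open>n\<close>, and \<open>?u\<close> is cancelled.\<close>
    have "F (x, 0) \<odot>\<^bsub>G\<^esub> U (src \<Lambda> x) z \<odot>\<^bsub>G\<^esub> ?u = F (x, 0) \<odot>\<^bsub>G\<^esub> U (src \<Lambda> x) (N_to_Z m)"
      using U(4)[OF o(1) z Z(3)] n(3) x z o y(2)
      by (simp add: U(1-3) x0 Z G.cmp_assoc)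
    also have "\<dots> = U (rng \<Lambda> x) (N_to_Z m) \<odot>\<^bsub>G\<^esub> F (\<beta> (- N_to_Z m) x, 0)" by (rule N[OF x n(1)])
    also have "\<dots> = U (rng \<Lambda> x) z \<odot>\<^bsub>G\<^esub> (U (rng \<Lambda> ?y) (N_to_Z n) \<odot>\<^bsub>G\<^esub> F (\<beta> (- N_to_Z n) ?y, 0))"
      unfolding n(3)[symmetric] U(4)[OF o(2) z Z(3)] y(3)[symmetric] y(4)[symmetric, folded n(3)]
      using z o y' by (intro G.cmp_assoc) (simp_all add: U(1-3) x0 Z y(3))
    also have "\<dots> = U (rng \<Lambda> x) z \<odot>\<^bsub>G\<^esub> (F (?y, 0) \<odot>\<^bsub>G\<^esub> ?u)"
      by (simp only: N[OF y(1) n(2)])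
    also have "\<dots> = U (rng \<Lambda> x) z \<odot>\<^bsub>G\<^esub> F (?y, 0) \<odot>\<^bsub>G\<^esub> ?u"
      using z o y by (intro G.cmp_assoc[symmetric]) (simp_all add: U(1-3) x0 Z)
    finally have eq: "F (x, 0) \<odot>\<^bsub>G\<^esub> U (src \<Lambda> x) z \<odot>\<^bsub>G\<^esub> ?u =
      U (rng \<Lambda> x) z \<odot>\<^bsub>G\<^esub> F (?y, 0) \<odot>\<^bsub>G\<^esub> ?u" .
    have u: "?u \<in> Mor G" "rng G ?u = F (src \<Lambda> ?y, 0)" using o(3) Z(3) by (simp_all add: U(1,2))
    have "F (x, 0) \<odot>\<^bsub>G\<^esub> U (src \<Lambda> x) z \<in> Mor G"
      "src G (F (x, 0) \<odot>\<^bsub>G\<^esub> U (src \<Lambda> x) z) = rng G ?u"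
      unfolding u(2) using x z o(1) y(2) by (simp_all add: U(1-3) x0 G.cmp_closed G.src_cmp)
    moreover have "U (rng \<Lambda> x) z \<odot>\<^bsub>G\<^esub> F (?y, 0) \<in> Mor G"
      "src G (U (rng \<Lambda> x) z \<odot>\<^bsub>G\<^esub> F (?y, 0)) = rng G ?u"
      unfolding u(2) using y(1,3) z o(2) by (simp_all add: U(1-3) x0 G.cmp_closed G.src_cmp)
    ultimately show ?thesis by (intro G.cancel_right[OF _ _ u(1) _ _ eq])
  qed
  \<comment> \<open>\<open>U\<close> is indexed by vertices of \<open>\<Lambda>\<close>, but sources
    in \<open>Pi_gpd \<Lambda>\<close> are classes. Passing back is possible because equal classes
    have equal ranges, so \<open>i_Pi \<Lambda>\<close> is injective on vertices.\<close>
  define e where "e = inv_into (Obj \<Lambda>) (i_Pi \<Lambda>)"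
  have e_i: "e (i_Pi \<Lambda> v) = v" if "v \<in> Obj \<Lambda>" for v
    unfolding e_def using that
    by (intro inv_into_f_f) (auto intro!: inj_onI dest!: i_Pi_eq_ends(2) simp: ObjD)
  have e: "e w \<in> Obj \<Lambda>" "i_Pi \<Lambda> (e w) = w" "H1 w = F (e w, 0)"
    "e (\<gamma> z w) = \<beta> z (e w)" "\<gamma> z w \<in> Obj (Pi_gpd \<Lambda>)" if w: "w \<in> Obj (Pi_gpd \<Lambda>)" "z \<in> Zvec l" for w z
  proof -
    obtain v where v: "v \<in> Obj \<Lambda>" "w = i_Pi \<Lambda> v" using w(1) unfolding i_Pi_Obj[symmetric] by auto
    then show "e w \<in> Obj \<Lambda>" "i_Pi \<Lambda> (e w) = w" "H1 w = F (e w, 0)" "e (\<gamma> z w) = \<beta> z (e w)"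
      using ObjD[OF v(1)] w(2) by (simp_all add: e_i H1(2) \<gamma>_i \<beta>_Obj)
    show "\<gamma> z w \<in> Obj (Pi_gpd \<Lambda>)" by (rule Pi.\<beta>_Obj[OF w(2,1)])
  qed
  note e0 = e[OF _ Zvec_0]
  \<comment> \<open>The exchange law for all groupoid elements: \<open>U\<close> at fixed
    \<open>z\<close> is a natural transformation from \<open>H1\<close> after
    \<open>\<gamma> (- z)\<close> to \<open>H1\<close>.\<close>
  have NAT: "H1 g \<odot>\<^bsub>G\<^esub> U (e (src (Pi_gpd \<Lambda>) g)) z = U (e (rng (Pi_gpd \<Lambda>) g)) z \<odot>\<^bsub>G\<^esub> H1 (\<gamma> (- z) g)"
    if g: "g \<in> Mor (Pi_gpd \<Lambda>)" and z: "z \<in> Zvec l" for g z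
  proof (rule natural_Pi[where \<tau> = "\<lambda>w. U (e w) z", OF assms(1) H1(1)
        functor_comp[OF Pi.\<beta>_functor[OF Zvec_minus[OF z]] H1(1)] _ _ g])
    fix w assume w: "w \<in> Obj (Pi_gpd \<Lambda>)"
    note e' = e[OF w Zvec_minus[OF z]]
    show "U (e w) z \<in> Mor G \<and> src G (U (e w) z) = H1 (\<gamma> (- z) w) \<and> rng G (U (e w) z) = H1 w"
      using e' e(3)[OF e'(5) z] z by (simp add: U(1-3))
  next
    fix x assume "x \<in> Mor \<Lambda>"
    then show "H1 (i_Pi \<Lambda> x) \<odot>\<^bsub>G\<^esub> U (e (i_Pi \<Lambda> (src \<Lambda> x))) z =
      U (e (i_Pi \<Lambda> (rng \<Lambda> x))) z \<odot>\<^bsub>G\<^esub> H1 (\<gamma> (- z) (i_Pi \<Lambda> x))"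
      using nat[of x z] z by (simp add: e_i src_Obj rng_Obj H1(2) \<gamma>_i Zvec_minus \<beta>_closed)
  qed
  have U0: "U v 0 = F (v, 0)" if "v \<in> Obj \<Lambda>" for v
    using U(5)[OF that Nvec_0] by (simp add: N_to_Z_0)
  \<comment> \<open>The formula is forced by the factorisation of \<open>(g, z)\<close> as
    \<open>(g, 0)\<close> times \<open>(src g, z)\<close>.\<close>
  define H where "H = (\<lambda>(g, z). H1 g \<odot>\<^bsub>G\<^esub> U (e (src (Pi_gpd \<Lambda>) g)) z)"
  have H: "H (g, z) = H1 g \<odot>\<^bsub>G\<^esub> U (e (src (Pi_gpd \<Lambda>) g)) z" for g z by (simp add: H_def)
  have types: "H1 g \<in> Mor G" "U (e (src (Pi_gpd \<Lambda>) g)) z \<in> Mor G"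
    "src G (H1 g) = rng G (U (e (src (Pi_gpd \<Lambda>) g)) z)"
    "src G (U (e (src (Pi_gpd \<Lambda>) g)) z) = H1 (\<gamma> (- z) (src (Pi_gpd \<Lambda>) g))"
    "rng G (H1 g) = H1 (rng (Pi_gpd \<Lambda>) g)"
    if "g \<in> Mor (Pi_gpd \<Lambda>)" "z \<in> Zvec l" for g z
  proof -
    note s = Pi.src_Obj[OF that(1)]
    note s' = e[OF s Zvec_minus[OF that(2)]]
    show "H1 g \<in> Mor G" "U (e (src (Pi_gpd \<Lambda>) g)) z \<in> Mor G"
      "src G (H1 g) = rng G (U (e (src (Pi_gpd \<Lambda>) g)) z)"
      "src G (U (e (src (Pi_gpd \<Lambda>) g)) z) = H1 (\<gamma> (- z) (src (Pi_gpd \<Lambda>) g))"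
      "rng G (H1 g) = H1 (rng (Pi_gpd \<Lambda>) g)"
      using that s' e0(3)[OF s'(5)] by (simp_all add: U(1-3) H1')
  qed
  have H_unit: "H (w, 0) = H1 w" if "w \<in> Obj (Pi_gpd \<Lambda>)" for w
  proof -
    have "H (w, 0) = H1 w \<odot>\<^bsub>G\<^esub> H1 w"
      using that e0[OF that] U0 by (simp add: H Pi.ObjD)
    also have "\<dots> = H1 w"
      using G.src_unit[of "H1 w"] H1'(1,2)[of w] Pi.ObjD[OF that] by simp
    finally show ?thesis .
  qed
  have "is_functor Q G H"
  proof (rule functorI)
    fix a assume "a \<in> Mor Q"
    then obtain g z where a: "a = (g, z)" "g \<in> Mor (Pi_gpd \<Lambda>)" "z \<in> Zvec l"
      by (auto simp: Pi.S_simps)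
    note t = types[OF a(2,3)]
    show "H a \<in> Mor G" using t by (simp add: a H G.cmp_closed)
    show "H (src Q a) = src G (H a)" "H (rng Q a) = rng G (H a)"
      using t a Pi.src_Obj[OF a(2)] Pi.rng_Obj[OF a(2)]
      by (auto simp: Pi.S_simps H_unit e(5) Zvec_minus H[of g z] G.src_cmp G.rng_cmp)
  next
    fix a b assume "a \<in> Mor Q" "b \<in> Mor Q" "src Q a = rng Q b"
    moreover obtain g z h w where a: "a = (g, z)" "b = (h, w)" by fastforce
    ultimately have g: "g \<in> Mor (Pi_gpd \<Lambda>)" "h \<in> Mor (Pi_gpd \<Lambda>)" "z \<in> Zvec l" "w \<in> Zvec l"
      and s: "src (Pi_gpd \<Lambda>) g = rng (Pi_gpd \<Lambda>) (\<gamma> z h)"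
      by (auto simp: Pi.S_simps Pi.S_composable)
    let ?k = "\<gamma> z h"
    have k: "?k \<in> Mor (Pi_gpd \<Lambda>)" "src (Pi_gpd \<Lambda>) ?k = \<gamma> z (src (Pi_gpd \<Lambda>) h)" "\<gamma> (- z) ?k = h"
      using g by (simp_all add: Pi.\<beta>_closed Pi.\<beta>_src Pi.\<beta>_minus)
    note sh = Pi.src_Obj[OF g(2)]
    have ek: "e (src (Pi_gpd \<Lambda>) ?k) = \<beta> z (e (src (Pi_gpd \<Lambda>) h))"
      unfolding k(2) using e[OF sh g(3)] by simp
    have ok: "e (src (Pi_gpd \<Lambda>) ?k) \<in> Obj \<Lambda>" by (rule e0(1)[OF Pi.src_Obj[OF k(1)]])
    have U_split: "U (e (src (Pi_gpd \<Lambda>) ?k)) (z + w) =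
      U (e (src (Pi_gpd \<Lambda>) ?k)) z \<odot>\<^bsub>G\<^esub> U (e (src (Pi_gpd \<Lambda>) h)) w"
      using U(4)[OF ok g(3,4)] ek ObjD(1)[OF e0(1)[OF sh]] g(3) by (simp add: \<beta>_minus)
    note tg = types[OF g(1,3)] and tk = types[OF k(1) g(3)] and th = types[OF g(2,4)]
    have sk: "src G (U (e (src (Pi_gpd \<Lambda>) ?k)) z) = rng G (U (e (src (Pi_gpd \<Lambda>) h)) w)"
      using tk(4) k(2) Pi.ObjD(1)[OF sh] g(3) th(3) H1'(2)[OF g(2)] by (simp add: Pi.\<beta>_minus)
    have sgk: "src G (H1 g) = rng G (H1 ?k)" using s g k by (simp add: H1')
    have sgh: "src G (U (e (src (Pi_gpd \<Lambda>) g)) z) = rng G (H1 h)"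
      using tg(4) s g H1'(3)[OF g(2)] by (simp add: Pi.\<beta>_rng[symmetric] Pi.\<beta>_minus Pi.rng_closed)
    have "H (a \<odot>\<^bsub>Q\<^esub> b) = H1 (g \<odot>\<^bsub>Pi_gpd \<Lambda>\<^esub> ?k) \<odot>\<^bsub>G\<^esub> U (e (src (Pi_gpd \<Lambda>) ?k)) (z + w)"
      using g k s by (simp add: a Pi.S_simps H Pi.src_cmp)
    also have "\<dots> = H1 g \<odot>\<^bsub>G\<^esub> (H1 ?k \<odot>\<^bsub>G\<^esub> U (e (src (Pi_gpd \<Lambda>) ?k)) z) \<odot>\<^bsub>G\<^esub> U (e (src (Pi_gpd \<Lambda>) h)) w"
      unfolding U_split H1'(4)[OF g(1) k(1) s] using tg tk th sk sgk
      by (simp add: G.cmp_assoc G.cmp_closed G.src_cmp G.rng_cmp)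
    \<comment> \<open>The exchange law for \<open>?k\<close> swaps the two middle factors;
      translating \<open>?k\<close> by \<open>- z\<close> returns \<open>h\<close>.\<close>
    also have "\<dots> = H1 g \<odot>\<^bsub>G\<^esub> (U (e (src (Pi_gpd \<Lambda>) g)) z \<odot>\<^bsub>G\<^esub> H1 h) \<odot>\<^bsub>G\<^esub> U (e (src (Pi_gpd \<Lambda>) h)) w"
      unfolding NAT[OF k(1) g(3)] k(3) s[symmetric] ..
    also have "\<dots> = H a \<odot>\<^bsub>G\<^esub> H b"
      unfolding a H using tg(1-3) th(1-3) sgh
      by (simp add: G.cmp_assoc G.cmp_closed G.src_cmp G.rng_cmp)
    finally show "H (a \<odot>\<^bsub>Q\<^esub> b) = H a \<odot>\<^bsub>G\<^esub> H b" .
  qed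
  moreover have "H (J a) = F a" if mor: "a \<in> Mor X" for a
  proof -
    obtain x n where a: "a = (x, n)" "x \<in> Mor \<Lambda>" "n \<in> Nvec l" using mor by (auto simp: X_simps)
    have "H (J a) = F (x, 0) \<odot>\<^bsub>G\<^esub> F (src \<Lambda> x, n)"
      using a src_Obj[OF a(2)] by (simp add: H H1(2) i_simps(2)[symmetric] e_i U(5))
    also have "\<dots> = F ((x, 0) \<odot>\<^bsub>X\<^esub> (src \<Lambda> x, n))"
      using a by (intro functor_cmp[OF F, symmetric])
        (simp_all add: X_simps Nvec_0 N_to_Z_0 \<beta>_0 src_closed rng_src)
    also have "\<dots> = F a" using a by (simp add: X_simps Nvec_0 N_to_Z_0 \<beta>_0 src_closed src_unit)
    finally show ?thesis .
  qed
  ultimately show thesis by (rule that)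
qed

lemma fundamental_groupoid_Q: "fundamental_groupoid TYPE('g) X Q J"
  unfolding fundamental_groupoid_def
proof (intro conjI allI impI Q.groupoid_axioms is_functor_J J_Obj)
  fix G :: "'g cat" and F
  assume "groupoid G \<and> is_functor X G F"
  then have G: "groupoid G" and F: "is_functor X G F" by auto
  obtain H where H: "is_functor Q G H" "\<And>a. a \<in> Mor X \<Longrightarrow> H (J a) = F a"
    using functor_Q_ex[OF G F] by metis
  let ?H = "restrict H (Mor Q)"
  have H': "is_functor Q G ?H"
    using H(1) by (auto simp: is_functor_def Q.src_closed Q.rng_closed Q.cmp_closed)
  have I: "induces X Q J G F ?H"
    using H H' functor_closed[OF is_functor_J] by (simp add: induces_def)
  show "\<exists>!H. induces X Q J G F H"
  proof (rule ex1I[of _ ?H])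
    show "induces X Q J G F ?H" by (rule I)
    fix K assume K: "induces X Q J G F K"
    show "K = ?H"
    proof (rule extensionalityI[of _ "Mor Q"])
      show "K \<in> extensional (Mor Q)" using K by (simp add: induces_def)
      fix a assume a: "a \<in> Mor Q"
      have "is_functor Q G K" "\<And>b. b \<in> Mor X \<Longrightarrow> K (J b) = F b"
        using K unfolding induces_def by blast+
      moreover have "\<And>b. b \<in> Mor X \<Longrightarrow> ?H (J b) = F b"
        using I unfolding induces_def by blast
      ultimately show "K a = ?H a" using functor_Q_unique[OF G _ H' _ a] by metis
    qed simp
  qed
qed

lemma inj_J:
  assumes "inj_on (i_Pi \<Lambda>) (Mor \<Lambda>)"
  shows "inj_on J (Mor X)"
  using assms by (auto simp: inj_on_def X_simps N_to_Z_inject)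

text \<open>Since \<open>Q\<close> is a groupoid, \<open>J\<close> takes equal values on morphisms
  with equal classes, and \<open>J\<close> is injective.\<close>

lemma inj_i_Pi_X:
  assumes "inj_on (i_Pi \<Lambda>) (Mor \<Lambda>)"
  shows "inj_on (i_Pi X) (Mor X)"
proof (rule inj_onI)
  fix a b assume a: "a \<in> Mor X" "b \<in> Mor X" and e: "i_Pi X a = i_Pi X b"
  have "J a = J b" by (rule X.i_Pi_eq_gpd[OF e a(1) Q.groupoid_axioms is_functor_J])
  then show "a = b" by (rule inj_onD[OF inj_J[OF assms] _ a])
qed

text \<open>Uniqueness of the fundamental groupoid tests \<open>Q\<close> both against itself and
  against \<open>Pi_gpd X\<close>, that is, at two types; \<open>fundamental_groupoid_Q\<close> is
  polymorphic and covers both.\<close>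

lemma is_cat_iso_induced: "is_cat_iso (Pi_gpd X) Q (induced_hom X Q J)"
  by (rule X.fundamental_groupoid_unique(2)) (rule fundamental_groupoid_Q)+

end

text \<open>Regarded as a homomorphism into the group \<open>Aut_cat \<Lambda>\<close>,
  \<open>\<alpha>\<close> extends to integer vectors by \<open>hom_Nmon_extend\<close>; agreement of
  inverses in the two automorphism groups gives the formula for sources.\<close>

lemma crossed_ex:
  assumes "category \<Lambda>" "\<alpha> \<in> hom (Nmon l) (Aut_kgraph \<Lambda>)"
  obtains \<beta> where "crossed \<Lambda> l \<beta> \<alpha>"
proof -
  note sub = Aut_kgraph_sub[OF assms(1)]
  have "\<alpha> \<in> hom (Nmon l) (Aut_cat \<Lambda>)" using assms(2) sub(1,2) by (auto simp: hom_def)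
  then obtain \<beta> where \<beta>: "\<beta> \<in> hom (Zgrp l) (Aut_cat \<Lambda>)" "\<And>n. n \<in> Nvec l \<Longrightarrow> \<beta> (N_to_Z n) = \<alpha> n"
    using hom_Nmon_extend[OF group_Aut_cat[OF assms(1)]] by metis
  interpret Z_action \<Lambda> l \<beta> by (simp add: Z_action_def Z_action_axioms_def assms(1) \<beta>(1))
  have "inv\<^bsub>Aut_kgraph \<Lambda>\<^esub> (\<alpha> n) = \<beta> (- N_to_Z n)" if "n \<in> Nvec l" for n
  proof -
    have "\<alpha> n \<in> carrier (Aut_kgraph \<Lambda>)" using assms(2) that by (auto simp: hom_def Nmon_def)
    then show ?thesis using sub(3) that \<beta>(2) by (simp add: \<beta>_hom_minus N_to_Z_Zvec)
  qed
  then show thesis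
    by (intro that[of \<beta>]) (simp add: crossed_def crossed_axioms_def Z_action_axioms \<beta>(2))
qed

theorem corollary3p15:
  fixes \<Lambda> :: "'a kgraph" and k :: nat
  assumes "k_graph k \<Lambda>"
    and "inj_on (i_Pi \<Lambda>) (Mor \<Lambda>)"
  shows
    "(\<forall>l f. affine_map l k f \<longrightarrow>
        inj_on (i_Pi (affine_pullback l f \<Lambda>)) (Mor (affine_pullback l f \<Lambda>))) \<and>
     (\<forall>l (\<Gamma> :: 'b kgraph). k_graph l \<Gamma> \<and> inj_on (i_Pi \<Gamma>) (Mor \<Gamma>) \<longrightarrow>
        inj_on (i_Pi (prod_graph k \<Lambda> \<Gamma>)) (Mor (prod_graph k \<Lambda> \<Gamma>))) \<and>
     (\<forall>(G :: 'g monoid) c. group G \<and> cocycle \<Lambda> G c \<longrightarrow>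
        inj_on (i_Pi (skew_product G c \<Lambda>)) (Mor (skew_product G c \<Lambda>))) \<and>
     (\<forall>l \<alpha>. \<alpha> \<in> hom (Nmon l) (Aut_kgraph \<Lambda>) \<longrightarrow>
        (\<exists>\<alpha>'. \<alpha>' \<in> hom (Zgrp l) (Aut_cat (Pi_gpd \<Lambda>)) \<and>
          (\<forall>n \<in> Nvec l. \<forall>x \<in> Mor \<Lambda>. \<alpha>' (N_to_Z n) (i_Pi \<Lambda> x) = i_Pi \<Lambda> (\<alpha> n x)) \<and>
          is_functor (crossed_product k l \<Lambda> \<alpha>) (semidirect_product l (Pi_gpd \<Lambda>) \<alpha>')
            (map_prod (i_Pi \<Lambda>) N_to_Z) \<and>
          inj_on (map_prod (i_Pi \<Lambda>) N_to_Z) (Mor (crossed_product k l \<Lambda> \<alpha>)) \<and>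
          inj_on (i_Pi (crossed_product k l \<Lambda> \<alpha>)) (Mor (crossed_product k l \<Lambda> \<alpha>)) \<and>
          is_cat_iso (Pi_gpd (crossed_product k l \<Lambda> \<alpha>)) (semidirect_product l (Pi_gpd \<Lambda>) \<alpha>')
            (induced_hom (crossed_product k l \<Lambda> \<alpha>) (semidirect_product l (Pi_gpd \<Lambda>) \<alpha>')
              (map_prod (i_Pi \<Lambda>) N_to_Z))))"
proof (intro conjI allI impI)
  interpret k_graph k \<Lambda> by fact
  show "inj_on (i_Pi (affine_pullback l f \<Lambda>)) (Mor (affine_pullback l f \<Lambda>))"
    if "affine_map l k f" for l f
    using assms that by (rule inj_i_Pi_affine_pullback)
  show "inj_on (i_Pi (prod_graph k \<Lambda> \<Gamma>)) (Mor (prod_graph k \<Lambda> \<Gamma>))"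
    if "k_graph l \<Gamma> \<and> inj_on (i_Pi \<Gamma>) (Mor \<Gamma>)" for l and \<Gamma> :: "'b kgraph"
    using that assms(2) by (intro inj_i_Pi_prod_graph category_axioms) (auto simp: k_graph_def)
  show "inj_on (i_Pi (skew_product G c \<Lambda>)) (Mor (skew_product G c \<Lambda>))"
    if "group G \<and> cocycle \<Lambda> G c" for G :: "'g monoid" and c
    using that assms(2) by (intro inj_i_Pi_skew_product category_axioms) auto
  fix l \<alpha> assume "\<alpha> \<in> hom (Nmon l) (Aut_kgraph \<Lambda>)"
  then obtain \<beta> where "crossed \<Lambda> l \<beta> \<alpha>" using crossed_ex[OF category_axioms] by metis
  then interpret crossed \<Lambda> l \<beta> k \<alpha> .
  show "\<exists>\<alpha>'. \<alpha>' \<in> hom (Zgrp l) (Aut_cat (Pi_gpd \<Lambda>)) \<and>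
      (\<forall>n \<in> Nvec l. \<forall>x \<in> Mor \<Lambda>. \<alpha>' (N_to_Z n) (i_Pi \<Lambda> x) = i_Pi \<Lambda> (\<alpha> n x)) \<and>
      is_functor (crossed_product k l \<Lambda> \<alpha>) (semidirect_product l (Pi_gpd \<Lambda>) \<alpha>')
        (map_prod (i_Pi \<Lambda>) N_to_Z) \<and>
      inj_on (map_prod (i_Pi \<Lambda>) N_to_Z) (Mor (crossed_product k l \<Lambda> \<alpha>)) \<and>
      inj_on (i_Pi (crossed_product k l \<Lambda> \<alpha>)) (Mor (crossed_product k l \<Lambda> \<alpha>)) \<and>
      is_cat_iso (Pi_gpd (crossed_product k l \<Lambda> \<alpha>)) (semidirect_product l (Pi_gpd \<Lambda>) \<alpha>')
        (induced_hom (crossed_product k l \<Lambda> \<alpha>) (semidirect_product l (Pi_gpd \<Lambda>) \<alpha>')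
          (map_prod (i_Pi \<Lambda>) N_to_Z))"
    \<comment> \<open>The witness is \<open>\<gamma>\<close>: extend \<open>\<alpha>\<close> to
      integer vectors on \<open>\<Lambda>\<close>, then apply \<open>Pi_map\<close>.\<close>
    using Pi.\<beta>_hom is_functor_J inj_J[OF assms(2)] inj_i_Pi_X[OF assms(2)] is_cat_iso_induced
    by (intro exI[of _ \<gamma>]) (simp add: \<gamma>_i \<alpha>_\<beta> N_to_Z_Zvec)
qed

end
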